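(* Let $\Bbbk$ be an algebraically closed field and let $\mathscr{C}$ be a locally-finite, pivotal, abelian, tensor $\Bbbk$-category which has enough projectives. Let $P$ be the projective cover of the unit object $\mathbf 1$ and let $\alpha$ be the socle of $P$. This data determines a right $\alpha$-trace $\mathsf{t}$ on the ideal $\mathcal{P}roj(\mathscr{C})$ of projective objects, which is unique up to scalar and which is nondegenerate in the sense that for all $Q\in\mathcal{P}roj(\mathscr{C})$ and $V\in\mathscr{C}$ the pairing $$\operatorname{Hom}_{\mathscr{C}}(V,Q)\times\operatorname{Hom}_{\mathscr{C}}(\alpha\otimes Q,V)\to\Bbbk,\qquad (g,f)\mapsto\mathsf{t}_Q(gf),$$ is non-degenerate.
   Context: Composition of morphisms is written $fg=f\circ g$. A pivotal tensor $\Bbbk$-category is a strict monoidal category $\mathscr{C}$ that is additive, with hom-sets $\Bbbk$-modules and with $\Bbbk$-bilinear composition and tensor product, such that $\Bbbk\to\operatorname{End}_{\mathscr{C}}(\mathbf{1})$, $k\mapsto k\operatorname{Id}_{\mathbf 1}$, is an isomorphism, and such that each object $V$ has a dual $V^*$ with morphisms $\operatorname{coev}_V:\mathbf 1\to V\otimes V^*$, $\operatorname{ev}_V:V^*\otimes V\to\mathbf 1$ and $\widetilde{\operatorname{coev}}_V:\mathbf 1\to V^*\otimes V$, $\widetilde{\operatorname{ev}}_V:V\otimes V^*\to\mathbf 1$ satisfying the zig-zag identities (left and right duality), for which the left and right duals of each morphism coincide and the two canonical isomorphisms $W^*\otimes V^*\to (V\otimes W)^*$ coincide (these are taken to be identities).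 Locally-finite: every $\operatorname{Hom}_{\mathscr{C}}(X,Y)$ has finite length over $\Bbbk$ and every object has finite length. Enough projectives: every object has a projective cover. In such a category the projective cover of a simple object has a unique simple subobject, called its socle. Right partial trace: for $g\in\operatorname{Hom}_{\mathscr{C}}(V\otimes W,X\otimes W)$, $\operatorname{tr}_r^W(g)=(\operatorname{Id}_X\otimes\widetilde{\operatorname{ev}}_W)(g\otimes\operatorname{Id}_{W^*})(\operatorname{Id}_V\otimes\operatorname{coev}_W)\in\operatorname{Hom}_{\mathscr{C}}(V,X)$. A right ideal is a full subcategory $I$ closed under $V\mapsto V\otimes W$ for all $W\in\mathscr{C}$ and under retracts; $\mathcal{P}roj(\mathscr{C})$ is one. A right $\alpha$-trace on $I$ (that is, a right $(\alpha,\mathbf 1)$-trace) is a family of $\Bbbk$-linear maps $\mathsf{t}_V:\operatorname{Hom}_{\mathscr{C}}(\alpha\otimes V,V)\to\Bbbk$, $V\in I$, with (1) $\mathsf{t}_{U\otimes W}(f)=\mathsf{t}_U(\operatorname{tr}_r^W(f))$ for $U\in I$, $W\in\mathscr{C}$, $f:\alpha\otimes U\otimes W\to U\otimes W$; (2) $\mathsf{t}_V(gf)=\mathsf{t}_U(f(\operatorname{Id}_\alpha\otimes g))$ for $U,V\in I$, $f:\alpha\otimes V\to U$, $g:U\to V$. "Unique up to scalar" means every right $\alpha$-trace on $\mathcal{P}roj(\mathscr{C})$ is a scalar multiple of $\mathsf{t}$. *)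

theory Defs
  imports "HOL-Computational_Algebra.Polynomial"
begin

section \<open>Categories\<close>

text \<open>
  A category is given by a set of objects and a set of arrows, each arrow carrying its domain
  and codomain; the values of the operations outside these sets are irrelevant.
  Composition is written \<open>g \<cdot> f\<close> for ``\<open>g\<close> after \<open>f\<close>''.
\<close>

record ('o, 'm) category_data =
  Obj :: "'o set" (\<open>Obj\<index>\<close>)
  Arr :: "'m set" (\<open>Arr\<index>\<close>)
  Dom :: "'m \<Rightarrow> 'o" (\<open>Dom\<index>\<close>)
  Cod :: "'m \<Rightarrow> 'o" (\<open>Cod\<index>\<close>)
  ide :: "'o \<Rightarrow> 'm" (\<open>ide\<index>\<close>)
  Comp :: "'m \<Rightarrow> 'm \<Rightarrow> 'm" (infixl \<open>\<cdot>\<index>\<close> 65)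

definition hom :: "('o, 'm, 'z) category_data_scheme \<Rightarrow> 'o \<Rightarrow> 'o \<Rightarrow> 'm set" (\<open>Hom\<index>\<close>)
  where "hom C X Y = {f \<in> Arr\<^bsub>C\<^esub>. Dom\<^bsub>C\<^esub> f = X \<and> Cod\<^bsub>C\<^esub> f = Y}"

locale category =
  fixes C :: "('o, 'm, 'z) category_data_scheme" (structure)
  assumes dom_obj: "f \<in> Arr \<Longrightarrow> Dom f \<in> Obj"
    and cod_obj: "f \<in> Arr \<Longrightarrow> Cod f \<in> Obj"
    and ide_hom: "X \<in> Obj \<Longrightarrow> ide X \<in> Hom X X"
    and comp_hom: "\<lbrakk>f \<in> Hom X Y; g \<in> Hom Y Z\<rbrakk> \<Longrightarrow> g \<cdot> f \<in> Hom X Z"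
    and comp_ide: "f \<in> Hom X Y \<Longrightarrow> f \<cdot> ide X = f"
    and ide_comp: "f \<in> Hom X Y \<Longrightarrow> ide Y \<cdot> f = f"
    and comp_assoc: "\<lbrakk>f \<in> Hom X Y; g \<in> Hom Y Z; h \<in> Hom Z W\<rbrakk> \<Longrightarrow> h \<cdot> (g \<cdot> f) = h \<cdot> g \<cdot> f"

context
  fixes C :: "('o, 'm, 'z) category_data_scheme" (structure)
begin

definition is_mono :: "'m \<Rightarrow> bool"
  where "is_mono m \<longleftrightarrow> m \<in> Arr \<and>
    (\<forall>X. \<forall>g \<in> Hom X (Dom m). \<forall>h \<in> Hom X (Dom m). m \<cdot> g = m \<cdot> h \<longrightarrow> g = h)"

definition is_epi :: "'m \<Rightarrow> bool"
  where "is_epi e \<longleftrightarrow> e \<in> Arr \<and>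
    (\<forall>Y. \<forall>g \<in> Hom (Cod e) Y. \<forall>h \<in> Hom (Cod e) Y. g \<cdot> e = h \<cdot> e \<longrightarrow> g = h)"

definition is_iso :: "'m \<Rightarrow> bool"
  where "is_iso f \<longleftrightarrow> f \<in> Arr \<and>
    (\<exists>g \<in> Hom (Cod f) (Dom f). g \<cdot> f = ide (Dom f) \<and> f \<cdot> g = ide (Cod f))"

definition is_zero_obj :: "'o \<Rightarrow> bool"
  where "is_zero_obj Z \<longleftrightarrow> Z \<in> Obj \<and>
    (\<forall>X \<in> Obj. (\<exists>!f. f \<in> Hom Z X) \<and> (\<exists>!f. f \<in> Hom X Z))"

definition is_projective :: "'o \<Rightarrow> bool"
  where "is_projective Q \<longleftrightarrow> Q \<in> Obj \<and>
    (\<forall>e f. is_epi e \<and> f \<in> Hom Q (Cod e) \<longrightarrow> (\<exists>g \<in> Hom Q (Dom e). e \<cdot> g = f))"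

definition projectives :: "'o set"
  where "projectives = {Q. is_projective Q}"

definition is_projective_cover :: "'o \<Rightarrow> 'o \<Rightarrow> bool"
  \<comment> \<open>The projective cover of \<open>X\<close> is a projective \<open>P\<close> with a superfluous epimorphism onto \<open>X\<close>.\<close>
  where "is_projective_cover P X \<longleftrightarrow> is_projective P \<and>
    (\<exists>p \<in> Hom P X. is_epi p \<and>
      (\<forall>g \<in> Arr. Cod g = P \<and> is_epi (p \<cdot> g) \<longrightarrow> is_epi g))"

definition enough_projectives :: bool
  where "enough_projectives \<longleftrightarrow> (\<forall>X \<in> Obj. \<exists>P. is_projective_cover P X)"

definition is_retract :: "'o \<Rightarrow> 'o \<Rightarrow> bool"
  where "is_retract U V \<longleftrightarrow> (\<exists>s \<in> Hom U V. \<exists>r \<in> Hom V U. r \<cdot> s = ide U)"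

end


section \<open>Linear, additive and abelian categories\<close>

record ('o, 'm, 'k) linear_category_data = "('o, 'm) category_data" +
  add :: "'m \<Rightarrow> 'm \<Rightarrow> 'm" (infixl \<open>\<oplus>\<index>\<close> 60)
  zero_arr :: "'o \<Rightarrow> 'o \<Rightarrow> 'm" (\<open>\<zero>\<index>\<close>)
  scale :: "'k \<Rightarrow> 'm \<Rightarrow> 'm" (infixr \<open>\<star>\<index>\<close> 80)

locale linear_category = category C
  for C :: "('o, 'm, 'k::comm_ring_1, 'z) linear_category_data_scheme" (structure) +
  assumes zero_hom: "\<lbrakk>X \<in> Obj; Y \<in> Obj\<rbrakk> \<Longrightarrow> \<zero> X Y \<in> Hom X Y"
    and add_hom: "\<lbrakk>f \<in> Hom X Y; g \<in> Hom X Y\<rbrakk> \<Longrightarrow> f \<oplus> g \<in> Hom X Y"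
    and scale_hom: "f \<in> Hom X Y \<Longrightarrow> a \<star> f \<in> Hom X Y"
    and add_assoc: "\<lbrakk>f \<in> Hom X Y; g \<in> Hom X Y; h \<in> Hom X Y\<rbrakk> \<Longrightarrow> f \<oplus> g \<oplus> h = f \<oplus> (g \<oplus> h)"
    and add_commute: "\<lbrakk>f \<in> Hom X Y; g \<in> Hom X Y\<rbrakk> \<Longrightarrow> f \<oplus> g = g \<oplus> f"
    and add_zero: "f \<in> Hom X Y \<Longrightarrow> f \<oplus> \<zero> X Y = f"
    and add_inverse: "f \<in> Hom X Y \<Longrightarrow> \<exists>g \<in> Hom X Y. f \<oplus> g = \<zero> X Y"
    and scale_add_right: "\<lbrakk>f \<in> Hom X Y; g \<in> Hom X Y\<rbrakk> \<Longrightarrow> a \<star> (f \<oplus> g) = a \<star> f \<oplus> a \<star> g"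
    and scale_add_left: "f \<in> Hom X Y \<Longrightarrow> (a + b) \<star> f = a \<star> f \<oplus> b \<star> f"
    and scale_scale: "f \<in> Hom X Y \<Longrightarrow> (a * b) \<star> f = a \<star> b \<star> f"
    and scale_one: "f \<in> Hom X Y \<Longrightarrow> 1 \<star> f = f"
    and comp_add_left: "\<lbrakk>f \<in> Hom X Y; g \<in> Hom Y Z; h \<in> Hom Y Z\<rbrakk> \<Longrightarrow> (g \<oplus> h) \<cdot> f = g \<cdot> f \<oplus> h \<cdot> f"
    and comp_add_right: "\<lbrakk>f \<in> Hom X Y; g \<in> Hom X Y; h \<in> Hom Y Z\<rbrakk> \<Longrightarrow> h \<cdot> (f \<oplus> g) = h \<cdot> f \<oplus> h \<cdot> g"
    and comp_scale_left: "\<lbrakk>f \<in> Hom X Y; g \<in> Hom Y Z\<rbrakk> \<Longrightarrow> (a \<star> g) \<cdot> f = a \<star> (g \<cdot> f)"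
    and comp_scale_right: "\<lbrakk>f \<in> Hom X Y; g \<in> Hom Y Z\<rbrakk> \<Longrightarrow> g \<cdot> (a \<star> f) = a \<star> (g \<cdot> f)"

locale additive_category = linear_category +
  assumes zero_obj_exists: "\<exists>Z. is_zero_obj C Z"
    and biproduct_exists: "\<lbrakk>X \<in> Obj; Y \<in> Obj\<rbrakk> \<Longrightarrow>
      \<exists>Z \<in> Obj. \<exists>i \<in> Hom X Z. \<exists>j \<in> Hom Y Z. \<exists>p \<in> Hom Z X. \<exists>q \<in> Hom Z Y.
        p \<cdot> i = ide X \<and> q \<cdot> j = ide Y \<and> q \<cdot> i = \<zero> X Y \<and> p \<cdot> j = \<zero> Y X \<and> i \<cdot> p \<oplus> j \<cdot> q = ide Z"

context
  fixes C :: "('o, 'm, 'k::comm_ring_1, 'z) linear_category_data_scheme" (structure)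
begin

definition is_kernel :: "'m \<Rightarrow> 'm \<Rightarrow> bool"
  where "is_kernel k f \<longleftrightarrow> f \<in> Arr \<and> k \<in> Arr \<and> Cod k = Dom f \<and>
    f \<cdot> k = \<zero> (Dom k) (Cod f) \<and>
    (\<forall>Z. \<forall>h \<in> Hom Z (Dom f). f \<cdot> h = \<zero> Z (Cod f) \<longrightarrow> (\<exists>!u. u \<in> Hom Z (Dom k) \<and> k \<cdot> u = h))"

definition is_cokernel :: "'m \<Rightarrow> 'm \<Rightarrow> bool"
  where "is_cokernel c f \<longleftrightarrow> f \<in> Arr \<and> c \<in> Arr \<and> Dom c = Cod f \<and>
    c \<cdot> f = \<zero> (Dom f) (Cod c) \<and>
    (\<forall>Z. \<forall>h \<in> Hom (Cod f) Z. h \<cdot> f = \<zero> (Dom f) Z \<longrightarrow> (\<exists>!u. u \<in> Hom (Cod c) Z \<and> u \<cdot> c = h))"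

definition is_simple :: "'o \<Rightarrow> bool"
  where "is_simple S \<longleftrightarrow> S \<in> Obj \<and> \<not> is_zero_obj C S \<and>
    (\<forall>m. is_mono C m \<and> Cod m = S \<longrightarrow> is_zero_obj C (Dom m) \<or> is_iso C m)"

definition obj_finite_length :: "'o \<Rightarrow> bool"
  \<comment> \<open>A composition series: \<open>F\<^sub>0 \<subseteq> F\<^sub>1 \<subseteq> \<dots> \<subseteq> F\<^sub>n\<close> with \<open>F\<^sub>0 = 0\<close>, \<open>F\<^sub>n = X\<close> and simple quotients.\<close>
  where "obj_finite_length X \<longleftrightarrow> (\<exists>n. \<exists>F :: nat \<Rightarrow> 'o. is_zero_obj C (F 0) \<and> F n = X \<and>
    (\<forall>i<n. \<exists>m \<in> Hom (F i) (F (Suc i)). \<exists>c. is_mono C m \<and> is_cokernel c m \<and> is_simple (Cod c)))"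

definition hom_submodule :: "'o \<Rightarrow> 'o \<Rightarrow> 'm set \<Rightarrow> bool"
  where "hom_submodule X Y N \<longleftrightarrow> N \<subseteq> Hom X Y \<and> \<zero> X Y \<in> N \<and>
    (\<forall>f \<in> N. \<forall>g \<in> N. f \<oplus> g \<in> N) \<and> (\<forall>a. \<forall>f \<in> N. a \<star> f \<in> N)"

definition hom_finite_length :: "'o \<Rightarrow> 'o \<Rightarrow> bool"
  \<comment> \<open>A composition series of the module \<open>Hom X Y\<close>; the quotient of consecutive terms is simple
    iff no submodule lies strictly in between.\<close>
  where "hom_finite_length X Y \<longleftrightarrow> (\<exists>n. \<exists>N :: nat \<Rightarrow> 'm set. N 0 = {\<zero> X Y} \<and> N n = Hom X Y \<and>
    (\<forall>i\<le>n. hom_submodule X Y (N i)) \<and>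
    (\<forall>i<n. N i \<subset> N (Suc i) \<and> \<not> (\<exists>M. hom_submodule X Y M \<and> N i \<subset> M \<and> M \<subset> N (Suc i))))"

definition locally_finite :: bool
  where "locally_finite \<longleftrightarrow>
    (\<forall>X \<in> Obj. \<forall>Y \<in> Obj. hom_finite_length X Y) \<and> (\<forall>X \<in> Obj. obj_finite_length X)"

definition is_socle :: "'o \<Rightarrow> 'o \<Rightarrow> bool"
  \<comment> \<open>\<open>A\<close> is the unique simple subobject of \<open>P\<close>; a subobject is a monomorphism into \<open>P\<close> up to
    isomorphism over \<open>P\<close>.\<close>
  where "is_socle A P \<longleftrightarrow> is_simple A \<and> (\<exists>i \<in> Hom A P. is_mono C i \<and>
    (\<forall>S. \<forall>j \<in> Hom S P. is_simple S \<and> is_mono C j \<longrightarrow>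
      (\<exists>u \<in> Hom S A. is_iso C u \<and> i \<cdot> u = j)))"

end

locale abelian_category = additive_category +
  assumes kernel_exists: "f \<in> Arr \<Longrightarrow> \<exists>k. is_kernel C k f"
    and cokernel_exists: "f \<in> Arr \<Longrightarrow> \<exists>c. is_cokernel C c f"
    and mono_is_kernel: "is_mono C m \<Longrightarrow> \<exists>f. is_kernel C m f"
    and epi_is_cokernel: "is_epi C e \<Longrightarrow> \<exists>f. is_cokernel C e f"


section \<open>Pivotal tensor categories\<close>

text \<open>
  \<open>coev X : 1 \<rightarrow> X \<otimes> X\<^sup>*\<close> and \<open>ev X : X\<^sup>* \<otimes> X \<rightarrow> 1\<close>, while the tilde versions
  \<open>coev' X : 1 \<rightarrow> X\<^sup>* \<otimes> X\<close> and \<open>ev' X : X \<otimes> X\<^sup>* \<rightarrow> 1\<close> are primed.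
  The tensor product is written \<open>\<odot>\<close> on objects and \<open>\<otimes>\<close> on arrows.
\<close>

record ('o, 'm, 'k) pivotal_data = "('o, 'm, 'k) linear_category_data" +
  unit :: 'o (\<open>\<one>\<index>\<close>)
  tensor_obj :: "'o \<Rightarrow> 'o \<Rightarrow> 'o" (infixl \<open>\<odot>\<index>\<close> 70)
  tensor_arr :: "'m \<Rightarrow> 'm \<Rightarrow> 'm" (infixl \<open>\<otimes>\<index>\<close> 70)
  dual :: "'o \<Rightarrow> 'o" (\<open>dual\<index>\<close>)
  coev :: "'o \<Rightarrow> 'm" (\<open>coev\<index>\<close>)
  ev :: "'o \<Rightarrow> 'm" (\<open>ev\<index>\<close>)
  coev' :: "'o \<Rightarrow> 'm" (\<open>coev''\<index>\<close>)
  ev' :: "'o \<Rightarrow> 'm" (\<open>ev''\<index>\<close>)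

locale tensor_category = additive_category C
  for C :: "('o, 'm, 'k::comm_ring_1, 'z) pivotal_data_scheme" (structure) +
  assumes unit_obj: "\<one> \<in> Obj"
    and tensor_obj: "\<lbrakk>X \<in> Obj; Y \<in> Obj\<rbrakk> \<Longrightarrow> X \<odot> Y \<in> Obj"
    and tensor_hom: "\<lbrakk>f \<in> Hom X Y; g \<in> Hom V W\<rbrakk> \<Longrightarrow> f \<otimes> g \<in> Hom (X \<odot> V) (Y \<odot> W)"
    and tensor_ide: "\<lbrakk>X \<in> Obj; Y \<in> Obj\<rbrakk> \<Longrightarrow> ide X \<otimes> ide Y = ide (X \<odot> Y)"
    and tensor_comp: "\<lbrakk>f \<in> Hom X Y; g \<in> Hom Y Z; h \<in> Hom U V; k \<in> Hom V W\<rbrakk> \<Longrightarrow>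
      (g \<cdot> f) \<otimes> (k \<cdot> h) = (g \<otimes> k) \<cdot> (f \<otimes> h)"
    and tensor_obj_assoc: "\<lbrakk>X \<in> Obj; Y \<in> Obj; Z \<in> Obj\<rbrakk> \<Longrightarrow> X \<odot> Y \<odot> Z = X \<odot> (Y \<odot> Z)"
    and tensor_obj_unit: "X \<in> Obj \<Longrightarrow> X \<odot> \<one> = X" "X \<in> Obj \<Longrightarrow> \<one> \<odot> X = X"
    and tensor_arr_assoc: "\<lbrakk>f \<in> Arr; g \<in> Arr; h \<in> Arr\<rbrakk> \<Longrightarrow> f \<otimes> g \<otimes> h = f \<otimes> (g \<otimes> h)"
    and tensor_arr_unit: "f \<in> Arr \<Longrightarrow> f \<otimes> ide \<one> = f" "f \<in> Arr \<Longrightarrow> ide \<one> \<otimes> f = f"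
    and tensor_add_left: "\<lbrakk>f \<in> Hom X Y; g \<in> Hom X Y; h \<in> Arr\<rbrakk> \<Longrightarrow> (f \<oplus> g) \<otimes> h = f \<otimes> h \<oplus> g \<otimes> h"
    and tensor_add_right: "\<lbrakk>f \<in> Hom X Y; g \<in> Hom X Y; h \<in> Arr\<rbrakk> \<Longrightarrow> h \<otimes> (f \<oplus> g) = h \<otimes> f \<oplus> h \<otimes> g"
    and tensor_scale_left: "\<lbrakk>f \<in> Arr; g \<in> Arr\<rbrakk> \<Longrightarrow> (a \<star> f) \<otimes> g = a \<star> (f \<otimes> g)"
    and tensor_scale_right: "\<lbrakk>f \<in> Arr; g \<in> Arr\<rbrakk> \<Longrightarrow> f \<otimes> (a \<star> g) = a \<star> (f \<otimes> g)"
    and scalars_bij: "bij_betw (\<lambda>a. a \<star> ide \<one>) UNIV (Hom \<one> \<one>)"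

text \<open>
  \<open>dual_tensor_iso V W\<close> and its primed version are the two canonical isomorphisms
  \<open>W\<^sup>* \<otimes> V\<^sup>* \<rightarrow> (V \<otimes> W)\<^sup>*\<close>. They are required to coincide, but not to be
  identities: their use as identifications is a notational convention only.
\<close>

context
  fixes C :: "('o, 'm, 'k::comm_ring_1, 'z) pivotal_data_scheme" (structure)
begin

definition dual_arr :: "'m \<Rightarrow> 'm"
  where "dual_arr f = (let V = Dom f; W = Cod f in
    (ev W \<otimes> ide (dual V)) \<cdot> (ide (dual W) \<otimes> f \<otimes> ide (dual V)) \<cdot> (ide (dual W) \<otimes> coev V))"

definition dual_arr' :: "'m \<Rightarrow> 'm"
  where "dual_arr' f = (let V = Dom f; W = Cod f in
    (ide (dual V) \<otimes> ev' W) \<cdot> (ide (dual V) \<otimes> f \<otimes> ide (dual W)) \<cdot> (coev' V \<otimes> ide (dual W)))"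

definition dual_tensor_iso :: "'o \<Rightarrow> 'o \<Rightarrow> 'm"
  where "dual_tensor_iso V W =
    (ev W \<otimes> ide (dual (V \<odot> W)))
    \<cdot> (ide (dual W) \<otimes> ev V \<otimes> ide (W \<odot> dual (V \<odot> W)))
    \<cdot> (ide (dual W \<odot> dual V) \<otimes> coev (V \<odot> W))"

definition dual_tensor_iso' :: "'o \<Rightarrow> 'o \<Rightarrow> 'm"
  where "dual_tensor_iso' V W =
    (ide (dual (V \<odot> W)) \<otimes> ev' V)
    \<cdot> (ide (dual (V \<odot> W) \<odot> V) \<otimes> ev' W \<otimes> ide (dual V))
    \<cdot> (coev' (V \<odot> W) \<otimes> ide (dual W \<odot> dual V))"

end

locale pivotal_tensor_category = tensor_category +
  assumes dual_obj: "V \<in> Obj \<Longrightarrow> dual V \<in> Obj"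
    and coev_hom: "V \<in> Obj \<Longrightarrow> coev V \<in> Hom \<one> (V \<odot> dual V)"
    and ev_hom: "V \<in> Obj \<Longrightarrow> ev V \<in> Hom (dual V \<odot> V) \<one>"
    and coev'_hom: "V \<in> Obj \<Longrightarrow> coev' V \<in> Hom \<one> (dual V \<odot> V)"
    and ev'_hom: "V \<in> Obj \<Longrightarrow> ev' V \<in> Hom (V \<odot> dual V) \<one>"
    and zigzag: "V \<in> Obj \<Longrightarrow> (ide V \<otimes> ev V) \<cdot> (coev V \<otimes> ide V) = ide V"
    and zigzag_dual: "V \<in> Obj \<Longrightarrow> (ev V \<otimes> ide (dual V)) \<cdot> (ide (dual V) \<otimes> coev V) = ide (dual V)"
    and zigzag': "V \<in> Obj \<Longrightarrow> (ev' V \<otimes> ide V) \<cdot> (ide V \<otimes> coev' V) = ide V"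
    and zigzag'_dual: "V \<in> Obj \<Longrightarrow> (ide (dual V) \<otimes> ev' V) \<cdot> (coev' V \<otimes> ide (dual V)) = ide (dual V)"
    and dual_arr_eq: "f \<in> Arr \<Longrightarrow> dual_arr C f = dual_arr' C f"
    and dual_tensor_iso_eq:
      "\<lbrakk>V \<in> Obj; W \<in> Obj\<rbrakk> \<Longrightarrow> dual_tensor_iso C V W = dual_tensor_iso' C V W"


section \<open>Right ideals and right traces\<close>

context
  fixes C :: "('o, 'm, 'k::comm_ring_1, 'z) pivotal_data_scheme" (structure)
begin

definition right_partial_trace :: "'o \<Rightarrow> 'o \<Rightarrow> 'o \<Rightarrow> 'm \<Rightarrow> 'm"
  \<comment> \<open>Meant for \<open>g \<in> Hom (V \<odot> W) (X \<odot> W)\<close>; \<open>V\<close> and \<open>X\<close> are arguments because they are not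
    determined by \<open>g\<close> and \<open>W\<close>.\<close>
  where "right_partial_trace V X W g =
    (ide X \<otimes> ev' W) \<cdot> (g \<otimes> ide (dual W)) \<cdot> (ide V \<otimes> coev W)"

definition right_ideal :: "'o set \<Rightarrow> bool"
  \<comment> \<open>A full subcategory is given by its set of objects.\<close>
  where "right_ideal I \<longleftrightarrow> I \<subseteq> Obj \<and>
    (\<forall>V \<in> I. \<forall>W \<in> Obj. V \<odot> W \<in> I) \<and>
    (\<forall>V \<in> I. \<forall>U \<in> Obj. is_retract C U V \<longrightarrow> U \<in> I)"

definition is_right_trace :: "'o \<Rightarrow> 'o set \<Rightarrow> ('o \<Rightarrow> 'm \<Rightarrow> 'k) \<Rightarrow> bool"
  where "is_right_trace A I t \<longleftrightarrow> right_ideal I \<and>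
    (\<forall>V \<in> I. \<forall>f \<in> Hom (A \<odot> V) V. \<forall>g \<in> Hom (A \<odot> V) V. t V (f \<oplus> g) = t V f + t V g) \<and>
    (\<forall>V \<in> I. \<forall>f \<in> Hom (A \<odot> V) V. \<forall>a. t V (a \<star> f) = a * t V f) \<and>
    (\<forall>U \<in> I. \<forall>W \<in> Obj. \<forall>f \<in> Hom (A \<odot> U \<odot> W) (U \<odot> W).
      t (U \<odot> W) f = t U (right_partial_trace (A \<odot> U) U W f)) \<and>
    (\<forall>U \<in> I. \<forall>V \<in> I. \<forall>f \<in> Hom (A \<odot> V) U. \<forall>g \<in> Hom U V.
      t V (g \<cdot> f) = t U (f \<cdot> (ide A \<otimes> g)))"

definition trace_nondegenerate :: "'o \<Rightarrow> 'o set \<Rightarrow> ('o \<Rightarrow> 'm \<Rightarrow> 'k) \<Rightarrow> bool"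
  where "trace_nondegenerate A I t \<longleftrightarrow> (\<forall>Q \<in> I. \<forall>V \<in> Obj.
    (\<forall>g \<in> Hom V Q. (\<forall>f \<in> Hom (A \<odot> Q) V. t Q (g \<cdot> f) = 0) \<longrightarrow> g = \<zero> V Q) \<and>
    (\<forall>f \<in> Hom (A \<odot> Q) V. (\<forall>g \<in> Hom V Q. t Q (g \<cdot> f) = 0) \<longrightarrow> f = \<zero> (A \<odot> Q) V))"

end

end

theory Submission
  imports Defs
begin

text \<open>
  Fix the projective cover \<open>p : P \<rightarrow> \<one>\<close> and the socle \<open>i : \<alpha> \<rightarrow> P\<close>. By Schur's lemma every
  morphism \<open>\<alpha> \<rightarrow> P\<close> is a scalar multiple of \<open>i\<close>. This gives, for each projective \<open>R\<close>, a pairing of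
  \<open>Hom R \<one>\<close> with \<open>Hom \<alpha> R\<close>: lift \<open>q : R \<rightarrow> \<one>\<close> to \<open>e : R \<rightarrow> P\<close> with \<open>p e = q\<close>, and let the value
  of the pairing on \<open>q\<close> and \<open>u\<close> be the scalar \<open>c\<close> with \<open>e u = c i\<close>. The lift does not matter,
  because a map \<open>R \<rightarrow> P\<close> that is killed by \<open>p\<close> also kills every \<open>u : \<alpha> \<rightarrow> R\<close>
  (\<open>radical_kills_socle\<close>).

  The pairing is natural in \<open>R\<close> and nondegenerate. If \<open>u \<noteq> 0\<close>, then \<open>u\<close> is mono, and since \<open>P\<close> is
  injective \<open>i\<close> extends along \<open>u\<close>. If \<open>q \<noteq> 0\<close>, then \<open>q\<close> is epi because the unit is simple
  (\<open>to_unit_epi\<close>), so its lift is epi by superfluousness of \<open>p\<close>; the lift has a section, and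
  composing the section with \<open>i\<close> gives a suitable \<open>u\<close>.

  The trace of \<open>f : \<alpha> \<otimes> V \<rightarrow> V\<close> is the pairing of the evaluation \<open>ev' V : V \<otimes> V\<^sup>* \<rightarrow> \<one>\<close> with the
  morphism \<open>\<alpha> \<rightarrow> V \<otimes> V\<^sup>*\<close> that corresponds to \<open>f\<close> by duality. Both trace axioms are
  instances of naturality: for cyclicity one moves \<open>g\<close> around through its dual, which needs left and
  right dual to agree, and for the partial trace one moves through the isomorphism
  \<open>W\<^sup>* \<otimes> V\<^sup>* \<rightarrow> (V \<otimes> W)\<^sup>*\<close>, which needs its left and right form to agree. Nondegeneracy of
  the trace is nondegeneracy of the pairing, for \<open>R = V \<otimes> Q\<^sup>*\<close>.

  For uniqueness, let \<open>e\<close> be a lift of \<open>ev' Q\<close> and \<open>s : Q \<rightarrow> P \<otimes> Q\<close> its transpose. Then \<open>s\<close> is a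
  section of \<open>p \<otimes> Q\<close>, so the two axioms reduce the value of any trace \<open>t\<close> on \<open>f\<close> to the value of
  \<open>t\<^sub>P\<close> on the partial trace of \<open>s f (\<alpha> \<otimes> p \<otimes> Q)\<close>. That partial trace is \<open>i \<otimes> p\<close> times
  the value of the constructed trace on \<open>f\<close>.
\<close>

section \<open>Typing and linearity\<close>

context category
begin

lemma homD: "f \<in> Hom X Y \<Longrightarrow> f \<in> Arr" "f \<in> Hom X Y \<Longrightarrow> Dom f = X" "f \<in> Hom X Y \<Longrightarrow> Cod f = Y"
  by (auto simp: hom_def)

lemma hom_obj: "f \<in> Hom X Y \<Longrightarrow> X \<in> Obj" "f \<in> Hom X Y \<Longrightarrow> Y \<in> Obj"
  using dom_obj cod_obj by (auto simp: hom_def)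

lemma ide_typing [simp]:
  "X \<in> Obj \<Longrightarrow> ide X \<in> Arr" "X \<in> Obj \<Longrightarrow> Dom (ide X) = X" "X \<in> Obj \<Longrightarrow> Cod (ide X) = X"
  using ide_hom by (auto simp: hom_def)

lemma comp_typing [simp]:
  assumes "f \<in> Arr" "g \<in> Arr" "Dom g = Cod f"
  shows "g \<cdot> f \<in> Arr" "Dom (g \<cdot> f) = Dom f" "Cod (g \<cdot> f) = Cod g"
  using comp_hom[of f "Dom f" "Cod f" g "Cod g"] assms by (auto simp: hom_def)

lemma comp_ide_arr [simp]: "\<lbrakk>f \<in> Arr; Dom f = X\<rbrakk> \<Longrightarrow> f \<cdot> ide X = f"
  using comp_ide[of f X "Cod f"] by (simp add: hom_def)

lemma ide_comp_arr [simp]: "\<lbrakk>f \<in> Arr; Cod f = Y\<rbrakk> \<Longrightarrow> ide Y \<cdot> f = f"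
  using ide_comp[of f "Dom f" Y] by (simp add: hom_def)

lemma comp_assoc_arr:
  "\<lbrakk>f \<in> Arr; g \<in> Arr; h \<in> Arr; Dom g = Cod f; Dom h = Cod g\<rbrakk> \<Longrightarrow> h \<cdot> g \<cdot> f = h \<cdot> (g \<cdot> f)"
  using comp_assoc[of f "Dom f" "Cod f" g "Cod g" h "Cod h"] by (simp add: hom_def)

lemma epi_cancel:
  "\<lbrakk>is_epi C e; e \<in> Hom X Y; g \<in> Hom Y Z; h \<in> Hom Y Z; g \<cdot> e = h \<cdot> e\<rbrakk> \<Longrightarrow> g = h"
  unfolding is_epi_def hom_def by blast

lemma epiI:
  assumes "e \<in> Hom X Y"
    and "\<And>Z g h. \<lbrakk>g \<in> Hom Y Z; h \<in> Hom Y Z; g \<cdot> e = h \<cdot> e\<rbrakk> \<Longrightarrow> g = h"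
  shows "is_epi C e"
  using assms unfolding is_epi_def by (auto simp: hom_def)

lemma mono_cancel:
  "\<lbrakk>is_mono C m; m \<in> Hom X Y; g \<in> Hom Z X; h \<in> Hom Z X; m \<cdot> g = m \<cdot> h\<rbrakk> \<Longrightarrow> g = h"
  unfolding is_mono_def hom_def by blast

lemma monoI:
  assumes "m \<in> Hom X Y"
    and "\<And>Z g h. \<lbrakk>g \<in> Hom Z X; h \<in> Hom Z X; m \<cdot> g = m \<cdot> h\<rbrakk> \<Longrightarrow> g = h"
  shows "is_mono C m"
  using assms unfolding is_mono_def by (auto simp: hom_def)

lemma projective_lift:
  assumes "is_projective C Q" "is_epi C e" "e \<in> Hom X Y" "f \<in> Hom Q Y"
  obtains g where "g \<in> Hom Q X" "e \<cdot> g = f"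
proof -
  have "f \<in> Hom Q (Cod e)" using assms(3,4) by (simp add: homD)
  then obtain g where "g \<in> Hom Q (Dom e)" "e \<cdot> g = f"
    using assms(1,2) unfolding is_projective_def by blast
  then show ?thesis using that assms(3) by (simp add: homD)
qed

lemma projectiveI:
  assumes "Q \<in> Obj"
    and "\<And>e f X Y. \<lbrakk>is_epi C e; e \<in> Hom X Y; f \<in> Hom Q Y\<rbrakk> \<Longrightarrow> \<exists>g \<in> Hom Q X. e \<cdot> g = f"
  shows "is_projective C Q"
  unfolding is_projective_def
proof (intro conjI allI impI)
  fix e f assume a: "is_epi C e \<and> f \<in> Hom Q (Cod e)"
  then have "e \<in> Hom (Dom e) (Cod e)" by (simp add: is_epi_def hom_def)
  with a assms(2) show "\<exists>g \<in> Hom Q (Dom e). e \<cdot> g = f" by blast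
qed (fact assms(1))

lemma retract_projective:
  assumes "is_projective C V" "is_retract C U V"
  shows "is_projective C U"
proof -
  obtain s r where s: "s \<in> Hom U V" and r: "r \<in> Hom V U" and rs: "r \<cdot> s = ide U"
    using assms(2) by (auto simp: is_retract_def)
  show ?thesis
  proof (rule projectiveI)
    show "U \<in> Obj" using hom_obj(1)[OF s] .
    fix e f X Y assume e: "is_epi C e" "e \<in> Hom X Y" and f: "f \<in> Hom U Y"
    obtain g where g: "g \<in> Hom V X" "e \<cdot> g = f \<cdot> r"
      using projective_lift[OF assms(1) e comp_hom[OF r f]] by blast
    have "e \<cdot> (g \<cdot> s) = (f \<cdot> r) \<cdot> s" using e g s comp_assoc by metis
    also have "\<dots> = f" using comp_assoc[OF s r f] rs comp_ide[OF f] by simp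
    finally show "\<exists>g \<in> Hom U X. e \<cdot> g = f" using comp_hom[OF s g(1)] by blast
  qed
qed

end

context linear_category
begin

lemma add_left_cancel_hom:
  assumes "f \<in> Hom X Y" "g \<in> Hom X Y" "h \<in> Hom X Y" "f \<oplus> g = f \<oplus> h"
  shows "g = h"
proof -
  obtain n where n: "n \<in> Hom X Y" "f \<oplus> n = \<zero> X Y" using add_inverse[OF assms(1)] by blast
  have cancel: "n \<oplus> (f \<oplus> k) = k" if k: "k \<in> Hom X Y" for k
  proof -
    have z: "\<zero> X Y \<in> Hom X Y" using zero_hom hom_obj[OF k] by simp
    have "n \<oplus> (f \<oplus> k) = n \<oplus> f \<oplus> k" using add_assoc[OF n(1) assms(1) k] by simp
    also have "n \<oplus> f = \<zero> X Y" using add_commute[OF n(1) assms(1)] n(2) by simp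
    also have "\<zero> X Y \<oplus> k = k" using add_commute[OF z k] add_zero[OF k] by simp
    finally show ?thesis .
  qed
  show ?thesis using cancel[OF assms(2)] unfolding assms(4) cancel[OF assms(3)] by (rule sym)
qed

lemma scale_zero_left: "f \<in> Hom X Y \<Longrightarrow> 0 \<star> f = \<zero> X Y"
proof -
  assume f: "f \<in> Hom X Y"
  have z: "\<zero> X Y \<in> Hom X Y" using zero_hom hom_obj[OF f] by simp
  have "0 \<star> f \<oplus> 0 \<star> f = 0 \<star> f \<oplus> \<zero> X Y"
    using scale_add_left[OF f, of 0 0] add_zero[OF scale_hom[OF f]] by simp
  then show ?thesis by (rule add_left_cancel_hom[OF scale_hom[OF f] scale_hom[OF f] z])
qed

lemma scale_zero_right: assumes "X \<in> Obj" "Y \<in> Obj" shows "a \<star> \<zero> X Y = \<zero> X Y"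
proof -
  have z: "\<zero> X Y \<in> Hom X Y" using assms by (rule zero_hom)
  have "a \<star> \<zero> X Y = a \<star> 0 \<star> \<zero> X Y" by (simp only: scale_zero_left[OF z])
  also have "\<dots> = (a * 0) \<star> \<zero> X Y" by (rule scale_scale[OF z, symmetric])
  also have "\<dots> = \<zero> X Y" using scale_zero_left[OF z] by simp
  finally show ?thesis .
qed

lemma comp_zero_right: assumes g: "g \<in> Hom Y Z" and "X \<in> Obj" shows "g \<cdot> \<zero> X Y = \<zero> X Z"
proof -
  have z: "\<zero> X Y \<in> Hom X Y" using assms hom_obj(1) by (intro zero_hom) auto
  have "g \<cdot> \<zero> X Y = g \<cdot> (0 \<star> \<zero> X Y)" by (simp only: scale_zero_left[OF z])
  also have "\<dots> = 0 \<star> (g \<cdot> \<zero> X Y)" by (rule comp_scale_right[OF z g])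
  also have "\<dots> = \<zero> X Z" by (rule scale_zero_left[OF comp_hom[OF z g]])
  finally show ?thesis .
qed

lemma comp_zero_left: assumes f: "f \<in> Hom X Y" and "Z \<in> Obj" shows "\<zero> Y Z \<cdot> f = \<zero> X Z"
proof -
  have z: "\<zero> Y Z \<in> Hom Y Z" using assms hom_obj(2) by (intro zero_hom) auto
  have "\<zero> Y Z \<cdot> f = (0 \<star> \<zero> Y Z) \<cdot> f" by (simp only: scale_zero_left[OF z])
  also have "\<dots> = 0 \<star> (\<zero> Y Z \<cdot> f)" by (rule comp_scale_left[OF f z])
  also have "\<dots> = \<zero> X Z" by (rule scale_zero_left[OF comp_hom[OF f z]])
  finally show ?thesis .
qed

definition diff :: "'m \<Rightarrow> 'm \<Rightarrow> 'm" (infixl \<open>\<ominus>\<close> 60)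
  where "f \<ominus> g = f \<oplus> (- 1) \<star> g"

lemma diff_hom: "\<lbrakk>f \<in> Hom X Y; g \<in> Hom X Y\<rbrakk> \<Longrightarrow> f \<ominus> g \<in> Hom X Y"
  by (simp add: diff_def add_hom scale_hom)

lemma diff_self: "f \<in> Hom X Y \<Longrightarrow> f \<ominus> f = \<zero> X Y"
  using scale_add_left[of f X Y 1 "- 1"] scale_one[of f X Y] scale_zero_left[of f X Y]
  by (simp add: diff_def)

lemma diff_eq_zero:
  assumes "f \<in> Hom X Y" "g \<in> Hom X Y" "f \<ominus> g = \<zero> X Y"
  shows "f = g"
proof -
  have m: "(- 1) \<star> g \<in> Hom X Y" using assms(2) by (rule scale_hom)
  have "(- 1) \<star> g \<oplus> f = f \<ominus> g" unfolding diff_def by (rule add_commute[OF m assms(1)])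
  also have "\<dots> = g \<ominus> g" using assms diff_self by simp
  also have "\<dots> = (- 1) \<star> g \<oplus> g" unfolding diff_def by (rule add_commute[OF assms(2) m])
  finally show ?thesis by (rule add_left_cancel_hom[OF m assms(1,2)])
qed

lemma comp_diff_right:
  assumes "f \<in> Hom X Y" "g \<in> Hom X Y" "h \<in> Hom Y Z"
  shows "h \<cdot> (f \<ominus> g) = h \<cdot> f \<ominus> h \<cdot> g"
  unfolding diff_def
  by (simp add: comp_add_right[OF assms(1) scale_hom[OF assms(2)] assms(3)]
      comp_scale_right[OF assms(2,3)])

lemma comp_diff_left:
  assumes "f \<in> Hom X Y" "g \<in> Hom Y Z" "h \<in> Hom Y Z"
  shows "(g \<ominus> h) \<cdot> f = g \<cdot> f \<ominus> h \<cdot> f"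
  unfolding diff_def
  by (simp add: comp_add_left[OF assms(1,2) scale_hom[OF assms(3)]]
      comp_scale_left[OF assms(1,3)])

lemma diff_zero: "f \<in> Hom X Y \<Longrightarrow> f \<ominus> \<zero> X Y = f"
  unfolding diff_def by (simp add: scale_zero_right add_zero hom_obj)

end

section \<open>Calculus of tensor products\<close>

context tensor_category
begin

declare tensor_obj [simp] unit_obj [simp] tensor_obj_assoc [simp] tensor_obj_unit [simp]
  tensor_arr_assoc [simp] tensor_arr_unit [simp] tensor_ide [simp]

lemma tensor_typing [simp]:
  assumes "f \<in> Arr" "g \<in> Arr"
  shows "f \<otimes> g \<in> Arr" "Dom (f \<otimes> g) = Dom f \<odot> Dom g" "Cod (f \<otimes> g) = Cod f \<odot> Cod g"
  using tensor_hom[of f "Dom f" "Cod f" g "Dom g" "Cod g"] assms by (auto simp: hom_def)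

lemma interchange:
  "\<lbrakk>f \<in> Arr; g \<in> Arr; h \<in> Arr; k \<in> Arr; Dom g = Cod f; Dom k = Cod h\<rbrakk>
    \<Longrightarrow> (g \<otimes> k) \<cdot> (f \<otimes> h) = (g \<cdot> f) \<otimes> (k \<cdot> h)"
  using tensor_comp[of f "Dom f" "Cod f" g "Cod g" h "Dom h" "Cod h" k "Cod k"]
  by (simp add: hom_def)

text \<open>
  String diagram identities are proved below by expanding both sides into composites of whiskered
  generators, associated to the right. Whiskers must be split into single objects before two layers
  can be compared, so \<open>tensor_ide\<close> is then used from right to left.
\<close>

lemma whisker_left:
  "\<lbrakk>f \<in> Arr; g \<in> Arr; Dom g = Cod f; X \<in> Obj\<rbrakk>
    \<Longrightarrow> ide X \<otimes> (g \<cdot> f) = (ide X \<otimes> g) \<cdot> (ide X \<otimes> f)"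
  by (simp add: interchange)

lemma whisker_right:
  "\<lbrakk>f \<in> Arr; g \<in> Arr; Dom g = Cod f; X \<in> Obj\<rbrakk>
    \<Longrightarrow> (g \<cdot> f) \<otimes> ide X = (g \<otimes> ide X) \<cdot> (f \<otimes> ide X)"
  by (simp add: interchange)

lemma slide:
  "\<lbrakk>f \<in> Hom X Y; g \<in> Hom V W\<rbrakk> \<Longrightarrow> (f \<otimes> ide W) \<cdot> (ide X \<otimes> g) = (ide Y \<otimes> g) \<cdot> (f \<otimes> ide V)"
  "\<lbrakk>f \<in> Hom X Y; g \<in> Hom V W\<rbrakk> \<Longrightarrow> (f \<otimes> ide W) \<cdot> (ide X \<otimes> g) = f \<otimes> g"
  "\<lbrakk>f \<in> Hom X Y; g \<in> Hom V W\<rbrakk> \<Longrightarrow> (ide Y \<otimes> g) \<cdot> (f \<otimes> ide V) = f \<otimes> g"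
  using hom_obj[of f X Y] hom_obj[of g V W] by (simp_all add: interchange homD)

lemma tensor_zero_left:
  assumes "X \<in> Obj" "Y \<in> Obj" and g: "g \<in> Hom V W"
  shows "\<zero> X Y \<otimes> g = \<zero> (X \<odot> V) (Y \<odot> W)"
proof -
  have z: "\<zero> X Y \<in> Hom X Y" using assms(1,2) by (rule zero_hom)
  have "\<zero> X Y \<otimes> g = (0 \<star> \<zero> X Y) \<otimes> g" by (simp only: scale_zero_left[OF z])
  also have "\<dots> = 0 \<star> (\<zero> X Y \<otimes> g)" by (rule tensor_scale_left[OF homD(1)[OF z] homD(1)[OF g]])
  also have "\<dots> = \<zero> (X \<odot> V) (Y \<odot> W)" by (rule scale_zero_left[OF tensor_hom[OF z g]])
  finally show ?thesis .
qed

lemma tensor_zero_right: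
  assumes "X \<in> Obj" "Y \<in> Obj" and g: "g \<in> Hom V W"
  shows "g \<otimes> \<zero> X Y = \<zero> (V \<odot> X) (W \<odot> Y)"
proof -
  have z: "\<zero> X Y \<in> Hom X Y" using assms(1,2) by (rule zero_hom)
  have "g \<otimes> \<zero> X Y = g \<otimes> (0 \<star> \<zero> X Y)" by (simp only: scale_zero_left[OF z])
  also have "\<dots> = 0 \<star> (g \<otimes> \<zero> X Y)" by (rule tensor_scale_right[OF homD(1)[OF g] homD(1)[OF z]])
  also have "\<dots> = \<zero> (V \<odot> X) (W \<odot> Y)" by (rule scale_zero_left[OF tensor_hom[OF g z]])
  finally show ?thesis .
qed

end

text \<open>
  An object \<open>W\<close> with a left dual \<open>D\<close>. In a pivotal category this covers both halves of the
  duality: \<open>(W, D)\<close> is \<open>(V, V\<^sup>*)\<close> with \<open>coev\<close>, \<open>ev\<close>, or \<open>(V\<^sup>*, V)\<close> with \<open>coev'\<close>, \<open>ev'\<close>. Bending the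
  strand \<open>W\<close> on the right gives the adjunction \<open>Hom (X \<otimes> W) Y = Hom X (Y \<otimes> D)\<close>, and bending
  \<open>D\<close> on the left gives \<open>Hom (D \<otimes> X) Y = Hom X (W \<otimes> Y)\<close>.
\<close>

locale dual_pair = tensor_category +
  fixes W D :: 'a and \<eta> \<epsilon> :: 'b
  assumes W [simp]: "W \<in> Obj" and D [simp]: "D \<in> Obj"
    and \<eta>: "\<eta> \<in> Hom \<one> (W \<odot> D)" and \<epsilon>: "\<epsilon> \<in> Hom (D \<odot> W) \<one>"
    and zigzag_W: "(ide W \<otimes> \<epsilon>) \<cdot> (\<eta> \<otimes> ide W) = ide W"
    and zigzag_D: "(\<epsilon> \<otimes> ide D) \<cdot> (ide D \<otimes> \<eta>) = ide D"
begin

lemmas unit_counit_typing [simp] = homD[OF \<eta>] homD[OF \<epsilon>]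

lemma bend_right_hom:
  "f \<in> Hom (X \<odot> W) Y \<Longrightarrow> X \<in> Obj \<Longrightarrow> (f \<otimes> ide D) \<cdot> (ide X \<otimes> \<eta>) \<in> Hom X (Y \<odot> D)"
  by (auto simp: hom_def)

lemma unbend_right_hom:
  "g \<in> Hom X (Y \<odot> D) \<Longrightarrow> Y \<in> Obj \<Longrightarrow> (ide Y \<otimes> \<epsilon>) \<cdot> (g \<otimes> ide W) \<in> Hom (X \<odot> W) Y"
  by (auto simp: hom_def)

lemma bend_left_hom:
  "f \<in> Hom (D \<odot> X) Y \<Longrightarrow> X \<in> Obj \<Longrightarrow> (ide W \<otimes> f) \<cdot> (\<eta> \<otimes> ide X) \<in> Hom X (W \<odot> Y)"
  by (auto simp: hom_def)

lemma unbend_left_hom: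
  "g \<in> Hom X (W \<odot> Y) \<Longrightarrow> Y \<in> Obj \<Longrightarrow> (\<epsilon> \<otimes> ide Y) \<cdot> (ide D \<otimes> g) \<in> Hom (D \<odot> X) Y"
  by (auto simp: hom_def)

lemma unbend_bend_right:
  assumes f: "f \<in> Hom (X \<odot> W) Y" and [simp]: "X \<in> Obj"
  shows "(ide Y \<otimes> \<epsilon>) \<cdot> (((f \<otimes> ide D) \<cdot> (ide X \<otimes> \<eta>)) \<otimes> ide W) = f"
proof -
  note [simp] = homD[OF f] hom_obj(2)[OF f]
  have "(ide Y \<otimes> \<epsilon>) \<cdot> (((f \<otimes> ide D) \<cdot> (ide X \<otimes> \<eta>)) \<otimes> ide W)
      = ((ide Y \<otimes> \<epsilon>) \<cdot> (f \<otimes> ide (D \<odot> W))) \<cdot> (ide X \<otimes> (\<eta> \<otimes> ide W))"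
    by (simp add: whisker_right comp_assoc_arr)
  also have "(ide Y \<otimes> \<epsilon>) \<cdot> (f \<otimes> ide (D \<odot> W)) = f \<cdot> (ide (X \<odot> W) \<otimes> \<epsilon>)"
    using slide(1)[OF f \<epsilon>] by simp
  also have "(f \<cdot> (ide (X \<odot> W) \<otimes> \<epsilon>)) \<cdot> (ide X \<otimes> (\<eta> \<otimes> ide W))
      = f \<cdot> (ide X \<otimes> ((ide W \<otimes> \<epsilon>) \<cdot> (\<eta> \<otimes> ide W)))"
    by (simp add: whisker_left comp_assoc_arr del: tensor_ide) (simp flip: tensor_ide)
  also have "\<dots> = f" by (simp add: zigzag_W)
  finally show ?thesis .
qed

lemma bend_unbend_right:
  assumes g: "g \<in> Hom X (Y \<odot> D)" and [simp]: "Y \<in> Obj"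
  shows "(((ide Y \<otimes> \<epsilon>) \<cdot> (g \<otimes> ide W)) \<otimes> ide D) \<cdot> (ide X \<otimes> \<eta>) = g"
proof -
  note [simp] = homD[OF g] hom_obj(1)[OF g]
  have "(((ide Y \<otimes> \<epsilon>) \<cdot> (g \<otimes> ide W)) \<otimes> ide D) \<cdot> (ide X \<otimes> \<eta>)
      = (ide Y \<otimes> (\<epsilon> \<otimes> ide D)) \<cdot> ((g \<otimes> ide (W \<odot> D)) \<cdot> (ide X \<otimes> \<eta>))"
    by (simp add: whisker_right comp_assoc_arr)
  also have "(g \<otimes> ide (W \<odot> D)) \<cdot> (ide X \<otimes> \<eta>) = (ide (Y \<odot> D) \<otimes> \<eta>) \<cdot> g"
    using slide(1)[OF g \<eta>] by simp
  also have "(ide Y \<otimes> (\<epsilon> \<otimes> ide D)) \<cdot> ((ide (Y \<odot> D) \<otimes> \<eta>) \<cdot> g)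
      = (ide Y \<otimes> ((\<epsilon> \<otimes> ide D) \<cdot> (ide D \<otimes> \<eta>))) \<cdot> g"
    by (simp add: whisker_left comp_assoc_arr del: tensor_ide) (simp flip: tensor_ide)
  also have "\<dots> = g" by (simp add: zigzag_D)
  finally show ?thesis .
qed

lemma unbend_bend_left:
  assumes f: "f \<in> Hom (D \<odot> X) Y" and [simp]: "X \<in> Obj"
  shows "(\<epsilon> \<otimes> ide Y) \<cdot> (ide D \<otimes> ((ide W \<otimes> f) \<cdot> (\<eta> \<otimes> ide X))) = f"
proof -
  note [simp] = homD[OF f] hom_obj(2)[OF f]
  have "(\<epsilon> \<otimes> ide Y) \<cdot> (ide D \<otimes> ((ide W \<otimes> f) \<cdot> (\<eta> \<otimes> ide X)))
      = ((\<epsilon> \<otimes> ide Y) \<cdot> (ide (D \<odot> W) \<otimes> f)) \<cdot> (ide D \<otimes> (\<eta> \<otimes> ide X))"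
    by (simp add: whisker_left comp_assoc_arr del: tensor_ide) (simp flip: tensor_ide)
  also have "(\<epsilon> \<otimes> ide Y) \<cdot> (ide (D \<odot> W) \<otimes> f) = f \<cdot> (\<epsilon> \<otimes> ide (D \<odot> X))"
    using slide(1)[OF \<epsilon> f] by simp
  also have "(f \<cdot> (\<epsilon> \<otimes> ide (D \<odot> X))) \<cdot> (ide D \<otimes> (\<eta> \<otimes> ide X))
      = f \<cdot> (((\<epsilon> \<otimes> ide D) \<cdot> (ide D \<otimes> \<eta>)) \<otimes> ide X)"
    by (simp add: whisker_right comp_assoc_arr)
  also have "\<dots> = f" by (simp add: zigzag_D)
  finally show ?thesis .
qed

lemma bend_unbend_left:
  assumes g: "g \<in> Hom X (W \<odot> Y)" and [simp]: "Y \<in> Obj"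
  shows "(ide W \<otimes> ((\<epsilon> \<otimes> ide Y) \<cdot> (ide D \<otimes> g))) \<cdot> (\<eta> \<otimes> ide X) = g"
proof -
  note [simp] = homD[OF g] hom_obj(1)[OF g]
  have "(ide W \<otimes> ((\<epsilon> \<otimes> ide Y) \<cdot> (ide D \<otimes> g))) \<cdot> (\<eta> \<otimes> ide X)
      = (ide W \<otimes> (\<epsilon> \<otimes> ide Y)) \<cdot> ((ide (W \<odot> D) \<otimes> g) \<cdot> (\<eta> \<otimes> ide X))"
    by (simp add: whisker_left comp_assoc_arr del: tensor_ide) (simp flip: tensor_ide)
  also have "(ide (W \<odot> D) \<otimes> g) \<cdot> (\<eta> \<otimes> ide X) = (\<eta> \<otimes> ide (W \<odot> Y)) \<cdot> g"
    using slide(1)[OF \<eta> g] by simp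
  also have "(ide W \<otimes> (\<epsilon> \<otimes> ide Y)) \<cdot> ((\<eta> \<otimes> ide (W \<odot> Y)) \<cdot> g)
      = (((ide W \<otimes> \<epsilon>) \<cdot> (\<eta> \<otimes> ide W)) \<otimes> ide Y) \<cdot> g"
    by (simp add: whisker_right comp_assoc_arr)
  also have "\<dots> = g" by (simp add: zigzag_W)
  finally show ?thesis .
qed

lemma bend_right_comp:
  assumes f: "f \<in> Hom (Y \<odot> W) Z" and e: "e \<in> Hom X Y"
  shows "((f \<cdot> (e \<otimes> ide W)) \<otimes> ide D) \<cdot> (ide X \<otimes> \<eta>) = ((f \<otimes> ide D) \<cdot> (ide Y \<otimes> \<eta>)) \<cdot> e"
proof -
  note [simp] = homD[OF f] homD[OF e] hom_obj[OF e]
  have "((f \<cdot> (e \<otimes> ide W)) \<otimes> ide D) \<cdot> (ide X \<otimes> \<eta>)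
      = (f \<otimes> ide D) \<cdot> ((e \<otimes> ide (W \<odot> D)) \<cdot> (ide X \<otimes> \<eta>))"
    by (simp add: whisker_right comp_assoc_arr)
  also have "(e \<otimes> ide (W \<odot> D)) \<cdot> (ide X \<otimes> \<eta>) = (ide Y \<otimes> \<eta>) \<cdot> e"
    using slide(1)[OF e \<eta>] by simp
  finally show ?thesis by (simp add: comp_assoc_arr)
qed

lemma bend_left_comp:
  assumes f: "f \<in> Hom (D \<odot> Y) Z" and e: "e \<in> Hom X Y"
  shows "(ide W \<otimes> (f \<cdot> (ide D \<otimes> e))) \<cdot> (\<eta> \<otimes> ide X) = ((ide W \<otimes> f) \<cdot> (\<eta> \<otimes> ide Y)) \<cdot> e"
proof -
  note [simp] = homD[OF f] homD[OF e] hom_obj[OF e]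
  have "(ide W \<otimes> (f \<cdot> (ide D \<otimes> e))) \<cdot> (\<eta> \<otimes> ide X)
      = (ide W \<otimes> f) \<cdot> ((ide (W \<odot> D) \<otimes> e) \<cdot> (\<eta> \<otimes> ide X))"
    by (simp add: whisker_left comp_assoc_arr del: tensor_ide) (simp flip: tensor_ide)
  also have "(ide (W \<odot> D) \<otimes> e) \<cdot> (\<eta> \<otimes> ide X) = (\<eta> \<otimes> ide Y) \<cdot> e"
    using slide(1)[OF \<eta> e] by simp
  finally show ?thesis by (simp add: comp_assoc_arr)
qed

lemma unbend_right_comp:
  assumes g: "g \<in> Hom X (Y \<odot> D)" and e: "e \<in> Hom Y Z"
  shows "(ide Z \<otimes> \<epsilon>) \<cdot> (((e \<otimes> ide D) \<cdot> g) \<otimes> ide W) = e \<cdot> ((ide Y \<otimes> \<epsilon>) \<cdot> (g \<otimes> ide W))"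
proof -
  note [simp] = homD[OF g] homD[OF e] hom_obj[OF e]
  have "(ide Z \<otimes> \<epsilon>) \<cdot> (((e \<otimes> ide D) \<cdot> g) \<otimes> ide W)
      = ((ide Z \<otimes> \<epsilon>) \<cdot> (e \<otimes> ide (D \<odot> W))) \<cdot> (g \<otimes> ide W)"
    by (simp add: whisker_right comp_assoc_arr)
  also have "(ide Z \<otimes> \<epsilon>) \<cdot> (e \<otimes> ide (D \<odot> W)) = e \<cdot> (ide Y \<otimes> \<epsilon>)"
    using slide(1)[OF e \<epsilon>] by simp
  finally show ?thesis by (simp add: comp_assoc_arr)
qed

lemma unbend_left_comp:
  assumes g: "g \<in> Hom X (W \<odot> Y)" and e: "e \<in> Hom Y Z"
  shows "(\<epsilon> \<otimes> ide Z) \<cdot> (ide D \<otimes> ((ide W \<otimes> e) \<cdot> g)) = e \<cdot> ((\<epsilon> \<otimes> ide Y) \<cdot> (ide D \<otimes> g))"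
proof -
  note [simp] = homD[OF g] homD[OF e] hom_obj[OF e]
  have "(\<epsilon> \<otimes> ide Z) \<cdot> (ide D \<otimes> ((ide W \<otimes> e) \<cdot> g))
      = ((\<epsilon> \<otimes> ide Z) \<cdot> (ide (D \<odot> W) \<otimes> e)) \<cdot> (ide D \<otimes> g)"
    by (simp add: whisker_left comp_assoc_arr del: tensor_ide) (simp flip: tensor_ide)
  also have "(\<epsilon> \<otimes> ide Z) \<cdot> (ide (D \<odot> W) \<otimes> e) = e \<cdot> (\<epsilon> \<otimes> ide Y)"
    using slide(1)[OF \<epsilon> e] by simp
  finally show ?thesis by (simp add: comp_assoc_arr)
qed

text \<open>Left adjoints preserve epimorphisms and right adjoints preserve monomorphisms.\<close>

lemma epi_tensor_right:
  assumes epi: "is_epi C e" and e: "e \<in> Hom X Y"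
  shows "is_epi C (e \<otimes> ide W)"
proof (rule epiI)
  show "e \<otimes> ide W \<in> Hom (X \<odot> W) (Y \<odot> W)" by (rule tensor_hom[OF e ide_hom[OF W]])
  fix Z g h assume g: "g \<in> Hom (Y \<odot> W) Z" and h: "h \<in> Hom (Y \<odot> W) Z"
    and eq: "g \<cdot> (e \<otimes> ide W) = h \<cdot> (e \<otimes> ide W)"
  have Y: "Y \<in> Obj" using hom_obj[OF e] by simp
  have "((g \<otimes> ide D) \<cdot> (ide Y \<otimes> \<eta>)) \<cdot> e = ((h \<otimes> ide D) \<cdot> (ide Y \<otimes> \<eta>)) \<cdot> e"
    unfolding bend_right_comp[OF g e, symmetric] bend_right_comp[OF h e, symmetric] eq ..
  then have "(g \<otimes> ide D) \<cdot> (ide Y \<otimes> \<eta>) = (h \<otimes> ide D) \<cdot> (ide Y \<otimes> \<eta>)"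
    by (rule epi_cancel[OF epi e bend_right_hom[OF g Y] bend_right_hom[OF h Y]])
  then show "g = h" by (metis unbend_bend_right[OF g Y] unbend_bend_right[OF h Y])
qed

lemma epi_tensor_left:
  assumes epi: "is_epi C e" and e: "e \<in> Hom X Y"
  shows "is_epi C (ide D \<otimes> e)"
proof (rule epiI)
  show "ide D \<otimes> e \<in> Hom (D \<odot> X) (D \<odot> Y)" by (rule tensor_hom[OF ide_hom[OF D] e])
  fix Z g h assume g: "g \<in> Hom (D \<odot> Y) Z" and h: "h \<in> Hom (D \<odot> Y) Z"
    and eq: "g \<cdot> (ide D \<otimes> e) = h \<cdot> (ide D \<otimes> e)"
  have Y: "Y \<in> Obj" using hom_obj[OF e] by simp
  have "((ide W \<otimes> g) \<cdot> (\<eta> \<otimes> ide Y)) \<cdot> e = ((ide W \<otimes> h) \<cdot> (\<eta> \<otimes> ide Y)) \<cdot> e"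
    unfolding bend_left_comp[OF g e, symmetric] bend_left_comp[OF h e, symmetric] eq ..
  then have "(ide W \<otimes> g) \<cdot> (\<eta> \<otimes> ide Y) = (ide W \<otimes> h) \<cdot> (\<eta> \<otimes> ide Y)"
    by (rule epi_cancel[OF epi e bend_left_hom[OF g Y] bend_left_hom[OF h Y]])
  then show "g = h" by (metis unbend_bend_left[OF g Y] unbend_bend_left[OF h Y])
qed

lemma mono_tensor_right:
  assumes mono: "is_mono C m" and m: "m \<in> Hom X Y"
  shows "is_mono C (m \<otimes> ide D)"
proof (rule monoI)
  show "m \<otimes> ide D \<in> Hom (X \<odot> D) (Y \<odot> D)" by (rule tensor_hom[OF m ide_hom[OF D]])
  fix Z g h assume g: "g \<in> Hom Z (X \<odot> D)" and h: "h \<in> Hom Z (X \<odot> D)"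
    and eq: "(m \<otimes> ide D) \<cdot> g = (m \<otimes> ide D) \<cdot> h"
  have X: "X \<in> Obj" using hom_obj[OF m] by simp
  have "m \<cdot> ((ide X \<otimes> \<epsilon>) \<cdot> (g \<otimes> ide W)) = m \<cdot> ((ide X \<otimes> \<epsilon>) \<cdot> (h \<otimes> ide W))"
    unfolding unbend_right_comp[OF g m, symmetric] unbend_right_comp[OF h m, symmetric] eq ..
  then have "(ide X \<otimes> \<epsilon>) \<cdot> (g \<otimes> ide W) = (ide X \<otimes> \<epsilon>) \<cdot> (h \<otimes> ide W)"
    by (rule mono_cancel[OF mono m unbend_right_hom[OF g X] unbend_right_hom[OF h X]])
  then show "g = h" by (metis bend_unbend_right[OF g X] bend_unbend_right[OF h X])
qed

text \<open>
  A left adjoint preserves projectives once its right adjoint preserves epimorphisms. In a single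
  dual pair the right adjoint \<open>- \<otimes> D\<close> need not do so, hence the extra premise; it holds as
  soon as \<open>D\<close> has a dual as well.
\<close>

lemma projective_tensor_right:
  assumes Q: "is_projective C Q"
    and epi: "\<And>e X Y. \<lbrakk>is_epi C e; e \<in> Hom X Y\<rbrakk> \<Longrightarrow> is_epi C (e \<otimes> ide D)"
  shows "is_projective C (Q \<odot> W)"
proof (rule projectiveI)
  have QO: "Q \<in> Obj" using Q by (simp add: is_projective_def)
  then show "Q \<odot> W \<in> Obj" by simp
  fix e f X Y assume e: "is_epi C e" "e \<in> Hom X Y" and f: "f \<in> Hom (Q \<odot> W) Y"
  have X: "X \<in> Obj" using hom_obj[OF e(2)] by simp
  obtain g where g: "g \<in> Hom Q (X \<odot> D)" "(e \<otimes> ide D) \<cdot> g = (f \<otimes> ide D) \<cdot> (ide Q \<otimes> \<eta>)"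
    using projective_lift[OF Q epi[OF e] tensor_hom[OF e(2) ide_hom[OF D]] bend_right_hom[OF f QO]]
    by blast
  have "e \<cdot> ((ide X \<otimes> \<epsilon>) \<cdot> (g \<otimes> ide W)) = f"
    unfolding unbend_right_comp[OF g(1) e(2), symmetric] g(2) by (rule unbend_bend_right[OF f QO])
  then show "\<exists>g \<in> Hom (Q \<odot> W) X. e \<cdot> g = f" using unbend_right_hom[OF g(1) X] by blast
qed

lemma projective_tensor_left:
  assumes Q: "is_projective C Q"
    and epi: "\<And>e X Y. \<lbrakk>is_epi C e; e \<in> Hom X Y\<rbrakk> \<Longrightarrow> is_epi C (ide W \<otimes> e)"
  shows "is_projective C (D \<odot> Q)"
proof (rule projectiveI)
  have QO: "Q \<in> Obj" using Q by (simp add: is_projective_def)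
  then show "D \<odot> Q \<in> Obj" by simp
  fix e f X Y assume e: "is_epi C e" "e \<in> Hom X Y" and f: "f \<in> Hom (D \<odot> Q) Y"
  have X: "X \<in> Obj" using hom_obj[OF e(2)] by simp
  obtain g where g: "g \<in> Hom Q (W \<odot> X)" "(ide W \<otimes> e) \<cdot> g = (ide W \<otimes> f) \<cdot> (\<eta> \<otimes> ide Q)"
    using projective_lift[OF Q epi[OF e] tensor_hom[OF ide_hom[OF W] e(2)] bend_left_hom[OF f QO]]
    by blast
  have "e \<cdot> ((\<epsilon> \<otimes> ide X) \<cdot> (ide D \<otimes> g)) = f"
    unfolding unbend_left_comp[OF g(1) e(2), symmetric] g(2) by (rule unbend_bend_left[OF f QO])
  then show "\<exists>g \<in> Hom (D \<odot> Q) X. e \<cdot> g = f" using unbend_left_hom[OF g(1) X] by blast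
qed

end

section \<open>Schur's lemma\<close>

context abelian_category
begin

lemma kernel_mono: "is_kernel C k f \<Longrightarrow> is_mono C k"
proof -
  assume k: "is_kernel C k f"
  show "is_mono C k"
  proof (rule monoI)
    show kh: "k \<in> Hom (Dom k) (Dom f)" using k by (simp add: is_kernel_def hom_def)
    have f: "f \<in> Hom (Dom f) (Cod f)" using k by (simp add: is_kernel_def hom_def)
    fix Z g h assume g: "g \<in> Hom Z (Dom k)" and h: "h \<in> Hom Z (Dom k)" and eq: "k \<cdot> g = k \<cdot> h"
    have "f \<cdot> (k \<cdot> g) = f \<cdot> k \<cdot> g" by (rule comp_assoc[OF g kh f])
    also have "\<dots> = \<zero> (Dom k) (Cod f) \<cdot> g" using k by (simp add: is_kernel_def)
    also have "\<dots> = \<zero> Z (Cod f)" using comp_zero_left[OF g] hom_obj[OF f] by simp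
    finally have "\<exists>!u. u \<in> Hom Z (Dom k) \<and> k \<cdot> u = k \<cdot> g"
      using k comp_hom[OF g kh] unfolding is_kernel_def by blast
    then show "g = h" using g h eq by auto
  qed
qed

text \<open>The kernel of a nonzero map out of a simple object is a proper subobject, hence zero.\<close>

lemma simple_mono:
  assumes S: "is_simple C S" and f: "f \<in> Hom S Y" and nz: "f \<noteq> \<zero> S Y"
  shows "is_mono C f"
proof (rule monoI[OF f])
  obtain k where k: "is_kernel C k f" using kernel_exists homD(1)[OF f] by blast
  have kh: "k \<in> Hom (Dom k) S" using k homD[OF f] by (simp add: is_kernel_def hom_def)
  have fk: "f \<cdot> k = \<zero> (Dom k) Y" using k homD[OF f] by (simp add: is_kernel_def)
  consider "is_zero_obj C (Dom k)" | "is_iso C k"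
    using S kernel_mono[OF k] homD[OF kh] by (auto simp: is_simple_def)
  then have zero: "is_zero_obj C (Dom k)"
  proof cases
    case 2
    then obtain l where l: "l \<in> Hom S (Dom k)" "k \<cdot> l = ide S"
      using homD[OF kh] by (auto simp: is_iso_def)
    have "f = f \<cdot> k \<cdot> l" using comp_assoc[OF l(1) kh f] l(2) comp_ide[OF f] by simp
    also have "\<dots> = \<zero> S Y" unfolding fk by (rule comp_zero_left[OF l(1) hom_obj(2)[OF f]])
    finally show ?thesis using nz by simp
  qed
  fix Z g h assume g: "g \<in> Hom Z S" and h: "h \<in> Hom Z S" and eq: "f \<cdot> g = f \<cdot> h"
  have "f \<cdot> (g \<ominus> h) = \<zero> Z Y"
    using comp_diff_right[OF g h f] diff_self[OF comp_hom[OF h f]] eq by simp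
  then obtain u where u: "u \<in> Hom Z (Dom k)" "k \<cdot> u = g \<ominus> h"
    using k diff_hom[OF g h] homD[OF f] unfolding is_kernel_def by metis
  have Z: "Z \<in> Obj" "Dom k \<in> Obj" using hom_obj[OF u(1)] .
  then have "u = \<zero> Z (Dom k)"
    using zero u(1) zero_hom unfolding is_zero_obj_def by blast
  then have "g \<ominus> h = \<zero> Z S" using u(2) comp_zero_right[OF kh Z(1)] by simp
  then show "g = h" by (rule diff_eq_zero[OF g h])
qed

lemma ide_simple_nonzero:
  assumes S: "is_simple C S"
  shows "ide S \<noteq> \<zero> S S"
proof
  assume id: "ide S = \<zero> S S"
  have o: "S \<in> Obj" using S by (simp add: is_simple_def)
  have 1: "f = \<zero> S X" if "f \<in> Hom S X" for f X
    using comp_ide[OF that] comp_zero_right[OF that o] id by simp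
  have 2: "f = \<zero> X S" if "f \<in> Hom X S" for f X
    using ide_comp[OF that] comp_zero_left[OF that o] id by simp
  have "is_zero_obj C S"
    unfolding is_zero_obj_def using o zero_hom 1 2 by blast
  then show False using S by (simp add: is_simple_def)
qed

end

locale algebraically_closed_abelian_category = abelian_category C
  for C :: "('o, 'm, 'k::alg_closed_field, 'z) linear_category_data_scheme" (structure)
begin

lemma scale_cancel:
  assumes f: "f \<in> Hom X Y" and nz: "f \<noteq> \<zero> X Y" and eq: "a \<star> f = b \<star> f"
  shows "a = b"
proof (rule ccontr)
  assume "a \<noteq> b"
  have "(a - b) \<star> f = a \<star> f \<ominus> b \<star> f"
    using scale_add_left[OF f, of a "- b"] scale_scale[OF f, of "- 1" b] by (simp add: diff_def)
  also have "\<dots> = \<zero> X Y" using eq diff_self[OF scale_hom[OF f]] by simp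
  finally have 0: "(a - b) \<star> f = \<zero> X Y" .
  have "f = inverse (a - b) \<star> (a - b) \<star> f"
    using scale_scale[OF f, of "inverse (a - b)" "a - b"] scale_one[OF f] \<open>a \<noteq> b\<close> by simp
  also have "\<dots> = \<zero> X Y" unfolding 0 using scale_zero_right hom_obj[OF f] by blast
  finally show False using nz by simp
qed

text \<open>Evaluation of a polynomial at an endomorphism by Horner's scheme.\<close>

definition endo_poly :: "'m \<Rightarrow> 'k poly \<Rightarrow> 'm"
  where "endo_poly u p = fold_coeffs (\<lambda>a r. a \<star> ide (Dom u) \<oplus> u \<cdot> r) p (\<zero> (Dom u) (Dom u))"

context
  fixes X :: 'o and u :: 'm
  assumes u: "u \<in> Hom X X"
begin

lemma ide_X: "ide X \<in> Hom X X" by (rule ide_hom[OF hom_obj(1)[OF u]])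

lemma zero_X: "\<zero> X X \<in> Hom X X" by (intro zero_hom hom_obj(1)[OF u])

lemma endo_poly_0 [simp]: "endo_poly u 0 = \<zero> X X"
  by (simp add: endo_poly_def homD[OF u])

lemma endo_poly_pCons [simp]: "endo_poly u (pCons a p) = a \<star> ide X \<oplus> u \<cdot> endo_poly u p"
proof (cases "p = 0 \<and> a = 0")
  case True
  have "0 \<star> ide X \<oplus> u \<cdot> \<zero> X X = \<zero> X X"
    using scale_zero_left[OF ide_X] comp_zero_right[OF u hom_obj(1)[OF u]] add_zero[OF zero_X]
    by simp
  with True show ?thesis by simp
next
  case False
  then show ?thesis by (auto simp: endo_poly_def homD[OF u])
qed

lemma endo_poly_hom: "endo_poly u p \<in> Hom X X"
proof (induction p)
  case 0
  then show ?case by (simp add: zero_X)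
next
  case (pCons a p)
  show ?case
    unfolding endo_poly_pCons by (intro add_hom scale_hom ide_X comp_hom[OF pCons.IH u])
qed

lemma endo_poly_add: "endo_poly u (p + q) = endo_poly u p \<oplus> endo_poly u q"
proof (induction p q rule: poly_induct2)
  case 0
  then show ?case by (simp add: add_zero[OF zero_X])
next
  case (pCons a p b q)
  let ?a = "a \<star> ide X" and ?b = "b \<star> ide X" and ?r = "u \<cdot> endo_poly u p" and ?s = "u \<cdot> endo_poly u q"
  note h = scale_hom[OF ide_X, of a] scale_hom[OF ide_X, of b]
    comp_hom[OF endo_poly_hom u, of p] comp_hom[OF endo_poly_hom u, of q]
  have "endo_poly u (pCons a p + pCons b q) = (?a \<oplus> ?b) \<oplus> (?r \<oplus> ?s)"
    by (simp add: pCons.IH scale_add_left[OF ide_X] comp_add_right[OF endo_poly_hom endo_poly_hom u])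
  also have "\<dots> = ?a \<oplus> (?b \<oplus> ?r \<oplus> ?s)"
    by (simp only: add_assoc[OF h(1,2) add_hom[OF h(3,4)]] add_assoc[OF h(2-4)])
  also have "\<dots> = ?a \<oplus> (?r \<oplus> ?b \<oplus> ?s)" by (simp only: add_commute[OF h(2,3)])
  also have "\<dots> = (?a \<oplus> ?r) \<oplus> (?b \<oplus> ?s)"
    by (simp only: add_assoc[OF h(1,3) add_hom[OF h(2,4)]] add_assoc[OF h(3,2,4)])
  finally show ?case by simp
qed

lemma endo_poly_smult: "endo_poly u (smult c p) = c \<star> endo_poly u p"
proof (induction p)
  case 0
  then show ?case using scale_zero_right hom_obj(1)[OF u] by simp
next
  case (pCons a p)
  then show ?case
    by (simp add: comp_scale_right[OF endo_poly_hom u] scale_scale[OF ide_X]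
        scale_add_right[OF scale_hom[OF ide_X] comp_hom[OF endo_poly_hom u]])
qed

lemma endo_poly_linear_factor:
  "endo_poly u ([:- c, 1:] * q) = (u \<ominus> c \<star> ide X) \<cdot> endo_poly u q"
proof -
  note h = comp_hom[OF endo_poly_hom u, of q] endo_poly_hom[of q]
  have "[:- c, 1:] * q = pCons 0 q + smult (- c) q" by (simp add: mult_pCons_left)
  then have "endo_poly u ([:- c, 1:] * q)
      = (0 \<star> ide X \<oplus> u \<cdot> endo_poly u q) \<oplus> (- c) \<star> endo_poly u q"
    by (simp only: endo_poly_add endo_poly_smult endo_poly_pCons)
  also have "0 \<star> ide X \<oplus> u \<cdot> endo_poly u q = u \<cdot> endo_poly u q"
    using scale_zero_left[OF ide_X] add_commute[OF zero_X h(1)] add_zero[OF h(1)] by simp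
  also have "(- c) \<star> endo_poly u q = (- 1) \<star> (c \<star> endo_poly u q)"
    using scale_scale[OF h(2), of "- 1" c] by simp
  also have "c \<star> endo_poly u q = (c \<star> ide X) \<cdot> endo_poly u q"
    using comp_scale_left[OF h(2) ide_X] ide_comp[OF h(2)] by simp
  finally show ?thesis
    using comp_diff_left[OF h(2) u scale_hom[OF ide_X]] by (simp add: diff_def)
qed

text \<open>
  In a composition series of \<open>Hom X X\<close> each term has codimension one in the next, and
  subtracting a multiple of a fixed polynomial does not change the degree of polynomials of larger
  degree. So for every term of the series there are polynomials of arbitrarily large degree
  whose value at \<open>u\<close> lies in that term; the bottom term is zero.
\<close>

lemma annihilating_polynomial:
  assumes fin: "hom_finite_length C X X"
  obtains p where "p \<noteq> 0" "endo_poly u p = \<zero> X X"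
proof -
  obtain n N where N0: "N 0 = {\<zero> X X}" and Nn: "N n = Hom X X"
    and sub: "\<forall>i\<le>n. hom_submodule C X X (N i)"
    and step: "\<forall>i<n. N i \<subset> N (Suc i) \<and>
      \<not> (\<exists>M. hom_submodule C X X M \<and> N i \<subset> M \<and> M \<subset> N (Suc i))"
    using fin unfolding hom_finite_length_def by auto
  have unbounded: "\<exists>p. degree p > d \<and> endo_poly u p \<in> N (n - j)" if "j \<le> n" for j d
    using that
  proof (induction j arbitrary: d)
    case 0
    show ?case
      by (intro exI[of _ "monom 1 (Suc d)"]) (simp add: degree_monom_eq Nn endo_poly_hom)
  next
    case (Suc j)
    define m where "m = n - Suc j"
    have m: "Suc m = n - j" "m < n" using Suc.prems by (auto simp: m_def)
    have IH: "\<exists>p. degree p > d \<and> endo_poly u p \<in> N (Suc m)" for d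
      using Suc.IH[of d] Suc.prems m by simp
    show ?case
    proof (cases "\<forall>b. endo_poly u b \<in> N (Suc m) \<longrightarrow> endo_poly u b \<in> N m")
      case True
      then show ?thesis using IH[of d] unfolding m_def[symmetric] by blast
    next
      case False
      then obtain b where b: "endo_poly u b \<in> N (Suc m)" "endo_poly u b \<notin> N m" by blast
      let ?b = "endo_poly u b"
      have bh: "?b \<in> Hom X X" by (rule endo_poly_hom)
      have s: "hom_submodule C X X (N m)" "hom_submodule C X X (N (Suc m))"
        using sub m(2) by simp_all
      have wh: "w \<in> Hom X X" if "w \<in> N m" for w using s that by (auto simp: hom_submodule_def)
      \<comment> \<open>The span of \<open>N m\<close> and the value at \<open>b\<close> is all of \<open>N (Suc m)\<close>, as no submodule lies strictly between.\<close>
      define M where "M = {w \<oplus> c \<star> ?b |w c. w \<in> N m}"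
      have MI: "w \<oplus> c \<star> ?b \<in> M" if "w \<in> N m" for w c using that by (auto simp: M_def)
      have zN: "\<zero> X X \<in> N m" using s by (simp add: hom_submodule_def)
      have zb: "f \<oplus> 0 \<star> ?b = f" if "f \<in> Hom X X" for f
        using scale_zero_left[OF bh] add_zero[OF that] by simp
      have "hom_submodule C X X M"
        unfolding hom_submodule_def
      proof (intro conjI ballI allI)
        show "M \<subseteq> Hom X X" using wh bh add_hom scale_hom by (auto simp: M_def)
        show "\<zero> X X \<in> M" using MI[OF zN, of 0] zb[OF zero_X] by simp
        fix f assume "f \<in> M"
        then obtain w c where f: "f = w \<oplus> c \<star> ?b" "w \<in> N m" by (auto simp: M_def)
        show "a \<star> f \<in> M" for a
        proof -
          have "a \<star> f = a \<star> w \<oplus> (a * c) \<star> ?b"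
            unfolding f by (simp add: scale_add_right[OF wh[OF f(2)] scale_hom[OF bh]] scale_scale[OF bh])
          moreover have "a \<star> w \<in> N m" using s f(2) by (simp add: hom_submodule_def)
          ultimately show ?thesis using MI by simp
        qed
        fix g assume "g \<in> M"
        then obtain v d where g: "g = v \<oplus> d \<star> ?b" "v \<in> N m" by (auto simp: M_def)
        note h = wh[OF f(2)] wh[OF g(2)] scale_hom[OF bh, of c] scale_hom[OF bh, of d]
        have "f \<oplus> g = w \<oplus> (c \<star> ?b \<oplus> (v \<oplus> d \<star> ?b))"
          unfolding f g by (rule add_assoc[OF h(1,3) add_hom[OF h(2,4)]])
        also have "c \<star> ?b \<oplus> (v \<oplus> d \<star> ?b) = v \<oplus> (c \<star> ?b \<oplus> d \<star> ?b)"
          using add_assoc[OF h(3,2,4)] add_assoc[OF h(2,3,4)] add_commute[OF h(2,3)] by metis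
        also have "w \<oplus> \<dots> = (w \<oplus> v) \<oplus> (c + d) \<star> ?b"
          using add_assoc[OF h(1,2) add_hom[OF h(3,4)]] scale_add_left[OF bh] by simp
        finally have "f \<oplus> g = (w \<oplus> v) \<oplus> (c + d) \<star> ?b" .
        moreover have "w \<oplus> v \<in> N m" using s f(2) g(2) by (simp add: hom_submodule_def)
        ultimately show "f \<oplus> g \<in> M" using MI by simp
      qed
      moreover have "N m \<subset> M"
      proof
        show "N m \<subseteq> M" using MI[of _ 0] zb wh by fastforce
        have "?b = \<zero> X X \<oplus> 1 \<star> ?b"
          using scale_one[OF bh] add_commute[OF zero_X bh] add_zero[OF bh] by simp
        then have "?b \<in> M" using MI[OF zN, of 1] by simp
        then show "N m \<noteq> M" using b(2) by blast
      qed
      moreover have "M \<subseteq> N (Suc m)"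
      proof
        fix f assume "f \<in> M"
        then obtain w c where f: "f = w \<oplus> c \<star> ?b" "w \<in> N m" by (auto simp: M_def)
        have "w \<in> N (Suc m)" using f(2) step m(2) by blast
        moreover have "c \<star> ?b \<in> N (Suc m)" using s b(1) by (simp add: hom_submodule_def)
        ultimately show "f \<in> N (Suc m)" unfolding f using s by (simp add: hom_submodule_def)
      qed
      ultimately have M: "M = N (Suc m)" using step m(2) by blast
      obtain p where p: "degree p > max d (degree b)" "endo_poly u p \<in> N (Suc m)"
        using IH by blast
      then have "endo_poly u p \<in> M" using M by simp
      then obtain w c where w: "endo_poly u p = w \<oplus> c \<star> ?b" "w \<in> N m"
        by (auto simp: M_def)
      have "degree (smult (- c) b) < degree p" using p(1) degree_smult_le[of "- c" b] by linarith
      then have "degree (p + smult (- c) b) = degree p" by (rule degree_add_eq_left)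
      moreover have "endo_poly u (p + smult (- c) b) = w"
      proof -
        have "endo_poly u (p + smult (- c) b) = w \<oplus> (c \<star> ?b \<oplus> (- c) \<star> ?b)"
          unfolding endo_poly_add endo_poly_smult w
          by (rule add_assoc[OF wh[OF w(2)] scale_hom[OF bh] scale_hom[OF bh]])
        also have "c \<star> ?b \<oplus> (- c) \<star> ?b = \<zero> X X"
          using scale_add_left[OF bh, of c "- c"] scale_zero_left[OF bh] by simp
        finally show ?thesis using add_zero[OF wh[OF w(2)]] by simp
      qed
      ultimately show ?thesis using w(2) p(1) by (intro exI[of _ "p + smult (- c) b"]) (simp add: m_def)
    qed
  qed
  obtain p where "degree p > 0" "endo_poly u p \<in> N (n - n)" using unbounded by blast
  moreover from this(1) have "p \<noteq> 0" by auto
  ultimately show ?thesis using that[of p] N0 by auto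
qed

text \<open>
  Split off linear factors \<open>X - c\<close> from an annihilating polynomial. Since \<open>u - c\<close> is zero
  or mono, either \<open>u = c\<close> or the cofactor still annihilates \<open>u\<close>.
\<close>

lemma schur:
  assumes S: "is_simple C X" and fin: "hom_finite_length C X X"
  shows "\<exists>c. u = c \<star> ide X"
proof -
  have "\<exists>c. u = c \<star> ide X" if "p \<noteq> 0" "endo_poly u p = \<zero> X X" for p
    using that
  proof (induction "degree p" arbitrary: p rule: less_induct)
    case less
    show ?case
    proof (cases "degree p = 0")
      case True
      then obtain c where c: "p = [:c:]" by (auto elim: degree_eq_zeroE)
      have "endo_poly u p = c \<star> ide X"
        unfolding c endo_poly_pCons endo_poly_0
        using comp_zero_right[OF u hom_obj(1)[OF u]] add_zero[OF scale_hom[OF ide_X]] by simp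
      then have "c \<star> ide X = 0 \<star> ide X" using less.prems(2) scale_zero_left[OF ide_X] by simp
      then have "c = 0" by (rule scale_cancel[OF ide_X ide_simple_nonzero[OF S]])
      then show ?thesis using less.prems(1) c by simp
    next
      case False
      then obtain c where "poly p c = 0" using alg_closed_imp_poly_has_root by blast
      then obtain q where q: "p = [:- c, 1:] * q" by (auto simp: poly_eq_0_iff_dvd)
      let ?v = "u \<ominus> c \<star> ide X"
      have v: "?v \<in> Hom X X" by (intro diff_hom u scale_hom ide_X)
      show ?thesis
      proof (cases "?v = \<zero> X X")
        case True
        then show ?thesis using diff_eq_zero[OF u scale_hom[OF ide_X]] by blast
      next
        case False
        have "?v \<cdot> endo_poly u q = ?v \<cdot> \<zero> X X"
          using less.prems(2) comp_zero_right[OF v hom_obj(1)[OF u]]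
          by (simp only: q endo_poly_linear_factor)
        then have "endo_poly u q = \<zero> X X"
          using mono_cancel[OF simple_mono[OF S v False] v endo_poly_hom zero_X] by blast
        moreover have "q \<noteq> 0" using less.prems(1) q by auto
        moreover have "degree q < degree p" using \<open>q \<noteq> 0\<close> unfolding q by (subst degree_mult_eq) auto
        ultimately show ?thesis using less.hyps by blast
      qed
    qed
  qed
  then show ?thesis using annihilating_polynomial[OF fin] by blast
qed

end

end

section \<open>Duality and projective objects\<close>

context pivotal_tensor_category
begin

declare dual_obj [simp]

lemma duality_typing [simp]:
  assumes "V \<in> Obj"
  shows "coev V \<in> Arr" "Dom (coev V) = \<one>" "Cod (coev V) = V \<odot> dual V"
    and "ev V \<in> Arr" "Dom (ev V) = dual V \<odot> V" "Cod (ev V) = \<one>"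
    and "coev' V \<in> Arr" "Dom (coev' V) = \<one>" "Cod (coev' V) = dual V \<odot> V"
    and "ev' V \<in> Arr" "Dom (ev' V) = V \<odot> dual V" "Cod (ev' V) = \<one>"
  using coev_hom[OF assms] ev_hom[OF assms] coev'_hom[OF assms] ev'_hom[OF assms]
  by (auto simp: hom_def)

lemma left_dual_pair: "V \<in> Obj \<Longrightarrow> dual_pair C V (dual V) (coev V) (ev V)"
  by unfold_locales (simp_all add: coev_hom ev_hom zigzag zigzag_dual)

lemma right_dual_pair: "V \<in> Obj \<Longrightarrow> dual_pair C (dual V) V (coev' V) (ev' V)"
  by unfold_locales (simp_all add: coev'_hom ev'_hom zigzag' zigzag'_dual)

lemma epi_tensor:
  assumes "is_epi C e" "e \<in> Hom X Y" "V \<in> Obj"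
  shows "is_epi C (e \<otimes> ide V)" "is_epi C (ide V \<otimes> e)"
  using dual_pair.epi_tensor_right[OF left_dual_pair[OF assms(3)] assms(1,2)]
    dual_pair.epi_tensor_left[OF right_dual_pair[OF assms(3)] assms(1,2)] .

lemma mono_tensor:
  assumes "is_mono C m" "m \<in> Hom X Y" "V \<in> Obj"
  shows "is_mono C (m \<otimes> ide V)"
  using dual_pair.mono_tensor_right[OF right_dual_pair[OF assms(3)] assms(1,2)] .

lemma projective_tensor:
  assumes Q: "is_projective C Q" and V: "V \<in> Obj"
  shows "is_projective C (Q \<odot> V)" "is_projective C (V \<odot> Q)"
proof -
  show "is_projective C (Q \<odot> V)"
    by (rule dual_pair.projective_tensor_right[OF left_dual_pair[OF V] Q])
      (rule epi_tensor(1)[OF _ _ dual_obj[OF V]])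
  show "is_projective C (V \<odot> Q)"
    by (rule dual_pair.projective_tensor_left[OF right_dual_pair[OF V] Q])
      (rule epi_tensor(2)[OF _ _ dual_obj[OF V]])
qed

lemma right_ideal_projectives: "right_ideal C (projectives C)"
  unfolding right_ideal_def projectives_def mem_Collect_eq
proof (intro conjI ballI impI subsetI)
  show "Q \<in> Obj" if "Q \<in> {Q. is_projective C Q}" for Q
    using that by (simp add: is_projective_def)
qed (auto intro: projective_tensor(1) elim: retract_projective)

lemma projective_dual:
  assumes Q: "is_projective C Q"
  shows "is_projective C (dual Q)"
proof (rule retract_projective)
  have QO [simp]: "Q \<in> Obj" using Q by (simp add: is_projective_def)
  show "is_projective C (dual Q \<odot> Q \<odot> dual Q)"
    by (intro projective_tensor Q dual_obj QO)
  show "is_retract C (dual Q) (dual Q \<odot> Q \<odot> dual Q)"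
    unfolding is_retract_def
  proof (intro bexI)
    show "(ide (dual Q) \<otimes> ev' Q) \<cdot> (coev' Q \<otimes> ide (dual Q)) = ide (dual Q)"
      by (rule zigzag'_dual[OF QO])
  qed (simp_all add: hom_def)
qed

lemma dual_arr_hom: "f \<in> Hom V W \<Longrightarrow> dual_arr C f \<in> Hom (dual W) (dual V)"
  using hom_obj[of f V W] by (auto simp: dual_arr_def Let_def hom_def)

text \<open>
  The dual of a morphism is a bent form of it, so unbending moves a morphism from one leg of
  a coevaluation or an evaluation to the other. The laws for \<open>coev\<close> and \<open>ev\<close> concern the left
  dual and the one for \<open>ev'\<close> the right dual; here they involve the same arrow by pivotality.
\<close>

lemma coev_dual_arr:
  assumes f: "f \<in> Hom V W"
  shows "(f \<otimes> ide (dual V)) \<cdot> coev V = (ide W \<otimes> dual_arr C f) \<cdot> coev W"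
proof -
  note [simp] = homD[OF f] hom_obj[OF f]
  have g: "(f \<otimes> ide (dual V)) \<cdot> coev V \<in> Hom \<one> (W \<odot> dual V)" by (simp add: hom_def)
  have "dual_arr C f = (ev W \<otimes> ide (dual V)) \<cdot> (ide (dual W) \<otimes> ((f \<otimes> ide (dual V)) \<cdot> coev V))"
    by (simp add: dual_arr_def Let_def whisker_left comp_assoc_arr)
  then show ?thesis
    using dual_pair.bend_unbend_left[OF left_dual_pair g] by simp
qed

lemma ev_dual_arr:
  assumes f: "f \<in> Hom V W"
  shows "ev W \<cdot> (ide (dual W) \<otimes> f) = ev V \<cdot> (dual_arr C f \<otimes> ide V)"
proof -
  note [simp] = homD[OF f] hom_obj[OF f]
  have g: "ev W \<cdot> (ide (dual W) \<otimes> f) \<in> Hom (dual W \<odot> V) \<one>" by (simp add: hom_def)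
  have "dual_arr C f = ((ev W \<cdot> (ide (dual W) \<otimes> f)) \<otimes> ide (dual V)) \<cdot> (ide (dual W) \<otimes> coev V)"
    by (simp add: dual_arr_def Let_def whisker_right comp_assoc_arr)
  then show ?thesis
    using dual_pair.unbend_bend_right[OF left_dual_pair g] by simp
qed

lemma ev'_dual_arr:
  assumes f: "f \<in> Hom V W"
  shows "ev' W \<cdot> (f \<otimes> ide (dual W)) = ev' V \<cdot> (ide V \<otimes> dual_arr C f)"
proof -
  note [simp] = homD[OF f] hom_obj[OF f]
  have g: "ev' W \<cdot> (f \<otimes> ide (dual W)) \<in> Hom (V \<odot> dual W) \<one>" by (simp add: hom_def)
  have "dual_arr C f = (ide (dual V) \<otimes> (ev' W \<cdot> (f \<otimes> ide (dual W)))) \<cdot> (coev' V \<otimes> ide (dual W))"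
    by (simp add: dual_arr_eq dual_arr'_def Let_def whisker_left comp_assoc_arr)
  then show ?thesis
    using dual_pair.unbend_bend_left[OF right_dual_pair g] by simp
qed

text \<open>
  Under bending, precomposition with the dual of \<open>m\<close> becomes postcomposition with \<open>m \<otimes> Z\<close>,
  which is mono.
\<close>

lemma dual_arr_epi:
  assumes mono: "is_mono C m" and m: "m \<in> Hom X Y"
  shows "is_epi C (dual_arr C m)"
proof (rule epiI[OF dual_arr_hom[OF m]])
  note [simp] = homD[OF m] hom_obj[OF m]
  note [simp] = homD[OF dual_arr_hom[OF m]]
  fix Z g h assume g: "g \<in> Hom (dual X) Z" and h: "h \<in> Hom (dual X) Z"
    and eq: "g \<cdot> dual_arr C m = h \<cdot> dual_arr C m"
  have Z [simp]: "Z \<in> Obj" using hom_obj[OF g] by simp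
  have bend: "(m \<otimes> ide Z) \<cdot> ((ide X \<otimes> f) \<cdot> coev X) = (ide Y \<otimes> (f \<cdot> dual_arr C m)) \<cdot> coev Y"
    if f: "f \<in> Hom (dual X) Z" for f
  proof -
    note [simp] = homD[OF f]
    have "(m \<otimes> ide Z) \<cdot> ((ide X \<otimes> f) \<cdot> coev X) = (ide Y \<otimes> f) \<cdot> ((m \<otimes> ide (dual X)) \<cdot> coev X)"
      using slide(1)[OF m f] by (simp add: comp_assoc_arr[symmetric])
    also have "\<dots> = (ide Y \<otimes> (f \<cdot> dual_arr C m)) \<cdot> coev Y"
      unfolding coev_dual_arr[OF m] by (simp add: whisker_left comp_assoc_arr)
    finally show ?thesis .
  qed
  have hom: "(ide X \<otimes> f) \<cdot> coev X \<in> Hom \<one> (X \<odot> Z)" if "f \<in> Hom (dual X) Z" for f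
    using homD[OF that] by (simp add: hom_def)
  have "(ide X \<otimes> g) \<cdot> coev X = (ide X \<otimes> h) \<cdot> coev X"
  proof (rule mono_cancel[OF mono_tensor[OF mono m Z] tensor_hom[OF m ide_hom[OF Z]] hom[OF g] hom[OF h]])
    show "(m \<otimes> ide Z) \<cdot> ((ide X \<otimes> g) \<cdot> coev X) = (m \<otimes> ide Z) \<cdot> ((ide X \<otimes> h) \<cdot> coev X)"
      unfolding bend[OF g] bend[OF h] eq ..
  qed
  moreover have "f = (ev X \<otimes> ide Z) \<cdot> (ide (dual X) \<otimes> ((ide X \<otimes> f) \<cdot> coev X))"
    if f: "f \<in> Hom (dual X) Z" for f
    using dual_pair.unbend_bend_left[OF left_dual_pair, of X f \<one> Z] f by simp
  ultimately show "g = h" using g h by metis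
qed

text \<open>
  Projective objects are injective. The dual of \<open>Q\<close> is projective, being a retract of
  \<open>Q\<^sup>* \<otimes> Q \<otimes> Q\<^sup>*\<close>, so the dual of \<open>f\<close> lifts through the dual of \<open>m\<close>, which is epi. The
  transpose of the lift is the extension.
\<close>

lemma projective_extend:
  assumes Q: "is_projective C Q" and mono: "is_mono C m" and m: "m \<in> Hom X Y" and f: "f \<in> Hom X Q"
  obtains g where "g \<in> Hom Y Q" "g \<cdot> m = f"
proof -
  note [simp] = homD[OF f] homD[OF m] hom_obj[OF f] hom_obj[OF m]
  obtain h where h: "h \<in> Hom (dual Q) (dual Y)" "dual_arr C m \<cdot> h = dual_arr C f"
    using projective_lift[OF projective_dual[OF Q] dual_arr_epi[OF mono m] dual_arr_hom[OF m]
        dual_arr_hom[OF f]] by blast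
  note [simp] = homD[OF h(1)] homD[OF dual_arr_hom[OF m]] homD[OF dual_arr_hom[OF f]]
  define g where "g = (ide Q \<otimes> ev Y) \<cdot> (((ide Q \<otimes> h) \<cdot> coev Q) \<otimes> ide Y)"
  have g: "g \<in> Hom Y Q" by (simp add: g_def hom_def)
  have "g \<cdot> m = (ide Q \<otimes> ev Y) \<cdot> ((ide Q \<otimes> h \<otimes> ide Y) \<cdot> ((coev Q \<otimes> ide Y) \<cdot> m))"
    by (simp add: g_def whisker_right comp_assoc_arr)
  also have "(coev Q \<otimes> ide Y) \<cdot> m = (ide (Q \<odot> dual Q) \<otimes> m) \<cdot> (coev Q \<otimes> ide X)"
    using slide(1)[OF coev_hom m, of Q] by simp
  also have "(ide Q \<otimes> h \<otimes> ide Y) \<cdot> ((ide (Q \<odot> dual Q) \<otimes> m) \<cdot> (coev Q \<otimes> ide X))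
      = (ide Q \<otimes> ((h \<otimes> ide Y) \<cdot> (ide (dual Q) \<otimes> m))) \<cdot> (coev Q \<otimes> ide X)"
    by (simp add: whisker_left comp_assoc_arr del: tensor_ide) (simp flip: tensor_ide)
  also have "(h \<otimes> ide Y) \<cdot> (ide (dual Q) \<otimes> m) = (ide (dual Y) \<otimes> m) \<cdot> (h \<otimes> ide X)"
    by (rule slide(1)[OF h(1) m])
  also have "(ide Q \<otimes> ev Y) \<cdot> ((ide Q \<otimes> ((ide (dual Y) \<otimes> m) \<cdot> (h \<otimes> ide X))) \<cdot> (coev Q \<otimes> ide X))
      = (ide Q \<otimes> (ev Y \<cdot> (ide (dual Y) \<otimes> m))) \<cdot> ((ide Q \<otimes> (h \<otimes> ide X)) \<cdot> (coev Q \<otimes> ide X))"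
    by (simp add: whisker_left comp_assoc_arr)
  also have "ev Y \<cdot> (ide (dual Y) \<otimes> m) = ev X \<cdot> (dual_arr C m \<otimes> ide X)"
    by (rule ev_dual_arr[OF m])
  also have "(ide Q \<otimes> (ev X \<cdot> (dual_arr C m \<otimes> ide X))) \<cdot> ((ide Q \<otimes> (h \<otimes> ide X)) \<cdot> (coev Q \<otimes> ide X))
      = (ide Q \<otimes> ev X) \<cdot> (((ide Q \<otimes> (dual_arr C m \<cdot> h)) \<cdot> coev Q) \<otimes> ide X)"
    by (simp add: whisker_left whisker_right comp_assoc_arr)
  also have "(ide Q \<otimes> (dual_arr C m \<cdot> h)) \<cdot> coev Q = (f \<otimes> ide (dual X)) \<cdot> coev X"
    unfolding h(2) by (rule coev_dual_arr[OF f, symmetric])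
  also have "(ide Q \<otimes> ev X) \<cdot> (((f \<otimes> ide (dual X)) \<cdot> coev X) \<otimes> ide X) = f"
    using dual_pair.unbend_bend_right[OF left_dual_pair, of X f \<one> Q] f by simp
  finally show ?thesis using that g by blast
qed

end

section \<open>Duality of tensor products\<close>

context tensor_category
begin

text \<open>
  The nested cups and caps on \<open>V \<otimes> W\<close>. In each zigzag the inner cup and the opposite cap are
  disjoint and slide past each other (\<open>cross_W\<close>, \<open>cross_D\<close>), which leaves one zigzag for \<open>V\<close>
  and one for \<open>W\<close>.
\<close>

lemma dual_pair_tensor:
  assumes "dual_pair C V A \<eta>\<^sub>1 \<epsilon>\<^sub>1" and "dual_pair C W B \<eta>\<^sub>2 \<epsilon>\<^sub>2"
  shows "dual_pair C (V \<odot> W) (B \<odot> A) ((ide V \<otimes> \<eta>\<^sub>2 \<otimes> ide A) \<cdot> \<eta>\<^sub>1) (\<epsilon>\<^sub>2 \<cdot> (ide B \<otimes> \<epsilon>\<^sub>1 \<otimes> ide W))"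
proof -
  interpret V: dual_pair C V A \<eta>\<^sub>1 \<epsilon>\<^sub>1 by fact
  interpret W: dual_pair C W B \<eta>\<^sub>2 \<epsilon>\<^sub>2 by fact
  have cross_W: "(ide (W \<odot> B) \<otimes> \<epsilon>\<^sub>1) \<cdot> (\<eta>\<^sub>2 \<otimes> ide (A \<odot> V)) = \<eta>\<^sub>2 \<cdot> \<epsilon>\<^sub>1"
    using slide(1)[OF W.\<eta> V.\<epsilon>] by simp
  have cross_D: "(\<epsilon>\<^sub>1 \<otimes> ide (W \<odot> B)) \<cdot> (ide (A \<odot> V) \<otimes> \<eta>\<^sub>2) = \<eta>\<^sub>2 \<cdot> \<epsilon>\<^sub>1"
    using slide(1)[OF V.\<epsilon> W.\<eta>] by simp
  show ?thesis
  proof unfold_locales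
    show "(ide V \<otimes> \<eta>\<^sub>2 \<otimes> ide A) \<cdot> \<eta>\<^sub>1 \<in> Hom \<one> (V \<odot> W \<odot> (B \<odot> A))"
      and "\<epsilon>\<^sub>2 \<cdot> (ide B \<otimes> \<epsilon>\<^sub>1 \<otimes> ide W) \<in> Hom (B \<odot> A \<odot> (V \<odot> W)) \<one>"
      by (simp_all add: hom_def)
    have "(ide (V \<odot> W) \<otimes> (\<epsilon>\<^sub>2 \<cdot> (ide B \<otimes> \<epsilon>\<^sub>1 \<otimes> ide W))) \<cdot> (((ide V \<otimes> \<eta>\<^sub>2 \<otimes> ide A) \<cdot> \<eta>\<^sub>1) \<otimes> ide (V \<odot> W))
        = (ide V \<otimes> (ide W \<otimes> \<epsilon>\<^sub>2)) \<cdot>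
          ((ide V \<otimes> (((ide (W \<odot> B) \<otimes> \<epsilon>\<^sub>1) \<cdot> (\<eta>\<^sub>2 \<otimes> ide (A \<odot> V))) \<otimes> ide W)) \<cdot> (\<eta>\<^sub>1 \<otimes> ide (V \<odot> W)))"
      by (simp add: whisker_left whisker_right comp_assoc_arr del: tensor_ide)
        (simp add: comp_assoc_arr flip: tensor_ide)
    also have "\<dots> = (ide V \<otimes> ((ide W \<otimes> \<epsilon>\<^sub>2) \<cdot> (\<eta>\<^sub>2 \<otimes> ide W))) \<cdot> (((ide V \<otimes> \<epsilon>\<^sub>1) \<cdot> (\<eta>\<^sub>1 \<otimes> ide V)) \<otimes> ide W)"
      unfolding cross_W
      by (simp add: whisker_left whisker_right comp_assoc_arr)
    also have "\<dots> = ide (V \<odot> W)"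
      by (simp add: V.zigzag_W W.zigzag_W)
    finally show "(ide (V \<odot> W) \<otimes> (\<epsilon>\<^sub>2 \<cdot> (ide B \<otimes> \<epsilon>\<^sub>1 \<otimes> ide W))) \<cdot>
        (((ide V \<otimes> \<eta>\<^sub>2 \<otimes> ide A) \<cdot> \<eta>\<^sub>1) \<otimes> ide (V \<odot> W)) = ide (V \<odot> W)" .
    have "((\<epsilon>\<^sub>2 \<cdot> (ide B \<otimes> \<epsilon>\<^sub>1 \<otimes> ide W)) \<otimes> ide (B \<odot> A)) \<cdot> (ide (B \<odot> A) \<otimes> ((ide V \<otimes> \<eta>\<^sub>2 \<otimes> ide A) \<cdot> \<eta>\<^sub>1))
        = (\<epsilon>\<^sub>2 \<otimes> ide (B \<odot> A)) \<cdot>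
          ((ide B \<otimes> (((\<epsilon>\<^sub>1 \<otimes> ide (W \<odot> B)) \<cdot> (ide (A \<odot> V) \<otimes> \<eta>\<^sub>2)) \<otimes> ide A)) \<cdot> (ide (B \<odot> A) \<otimes> \<eta>\<^sub>1))"
      by (simp add: whisker_left whisker_right comp_assoc_arr del: tensor_ide)
        (simp add: comp_assoc_arr flip: tensor_ide)
    also have "\<dots> = (((\<epsilon>\<^sub>2 \<otimes> ide B) \<cdot> (ide B \<otimes> \<eta>\<^sub>2)) \<otimes> ide A) \<cdot> (ide B \<otimes> ((\<epsilon>\<^sub>1 \<otimes> ide A) \<cdot> (ide A \<otimes> \<eta>\<^sub>1)))"
      unfolding cross_D
      by (simp add: whisker_left whisker_right comp_assoc_arr del: tensor_ide)
        (simp add: comp_assoc_arr flip: tensor_ide)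
    also have "\<dots> = ide (B \<odot> A)"
      by (simp add: V.zigzag_D W.zigzag_D)
    finally show "((\<epsilon>\<^sub>2 \<cdot> (ide B \<otimes> \<epsilon>\<^sub>1 \<otimes> ide W)) \<otimes> ide (B \<odot> A)) \<cdot>
        (ide (B \<odot> A) \<otimes> ((ide V \<otimes> \<eta>\<^sub>2 \<otimes> ide A) \<cdot> \<eta>\<^sub>1)) = ide (B \<odot> A)" .
  qed simp_all
qed

end

context pivotal_tensor_category
begin

context
  fixes V W
  assumes V [simp]: "V \<in> Obj" and W [simp]: "W \<in> Obj"
begin

lemma dual_tensor_iso_hom: "dual_tensor_iso C V W \<in> Hom (dual W \<odot> dual V) (dual (V \<odot> W))"
  by (simp add: dual_tensor_iso_def hom_def)

text \<open>
  The canonical isomorphism compares the nested cups and caps with the given duality of \<open>V \<otimes> W\<close>.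
  Its left form is characterised by the coevaluations and its right form by the primed
  evaluations; since the two forms coincide, a single arrow satisfies both laws.
\<close>

lemma coev_tensor:
  "(ide (V \<odot> W) \<otimes> dual_tensor_iso C V W) \<cdot> ((ide V \<otimes> coev W \<otimes> ide (dual V)) \<cdot> coev V)
    = coev (V \<odot> W)"
proof -
  have "dual_tensor_iso C V W = ((ev W \<cdot> (ide (dual W) \<otimes> ev V \<otimes> ide W)) \<otimes> ide (dual (V \<odot> W))) \<cdot>
      (ide (dual W \<odot> dual V) \<otimes> coev (V \<odot> W))"
    by (simp add: dual_tensor_iso_def whisker_right comp_assoc_arr)
  then show ?thesis
    using dual_pair.bend_unbend_left[OF dual_pair_tensor[OF left_dual_pair[OF V] left_dual_pair[OF W]],
        of "coev (V \<odot> W)" \<one> "dual (V \<odot> W)"] coev_hom[of "V \<odot> W"]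
    by simp
qed

lemma ev'_tensor:
  "ev' (V \<odot> W) \<cdot> (ide (V \<odot> W) \<otimes> dual_tensor_iso C V W)
    = ev' V \<cdot> (ide V \<otimes> ev' W \<otimes> ide (dual V))"
proof -
  have f: "ev' V \<cdot> (ide V \<otimes> ev' W \<otimes> ide (dual V)) \<in> Hom (V \<odot> W \<odot> (dual W \<odot> dual V)) \<one>"
    by (simp add: hom_def)
  have "dual_tensor_iso C V W = (ide (dual (V \<odot> W)) \<otimes> (ev' V \<cdot> (ide V \<otimes> ev' W \<otimes> ide (dual V)))) \<cdot>
      (coev' (V \<odot> W) \<otimes> ide (dual W \<odot> dual V))"
    unfolding dual_tensor_iso_eq[OF V W] dual_tensor_iso'_def
    by (simp add: whisker_left comp_assoc_arr del: tensor_ide)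
      (simp flip: tensor_ide)
  then show ?thesis
    using dual_pair.unbend_bend_left[OF right_dual_pair[of "V \<odot> W"] f] by simp
qed

end

end

section \<open>The unit object is simple\<close>

context abelian_category
begin

lemma cokernel_epi: "is_cokernel C c f \<Longrightarrow> is_epi C c"
proof -
  assume c: "is_cokernel C c f"
  show "is_epi C c"
  proof (rule epiI)
    show ch: "c \<in> Hom (Cod f) (Cod c)" using c by (simp add: is_cokernel_def hom_def)
    have f: "f \<in> Hom (Dom f) (Cod f)" using c by (simp add: is_cokernel_def hom_def)
    fix Z g h assume g: "g \<in> Hom (Cod c) Z" and h: "h \<in> Hom (Cod c) Z" and eq: "g \<cdot> c = h \<cdot> c"
    have "g \<cdot> c \<cdot> f = g \<cdot> (c \<cdot> f)" by (rule comp_assoc[OF f ch g, symmetric])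
    also have "\<dots> = g \<cdot> \<zero> (Dom f) (Cod c)" using c by (simp add: is_cokernel_def)
    also have "\<dots> = \<zero> (Dom f) Z" using comp_zero_right[OF g] hom_obj[OF f] by simp
    finally have "\<exists>!u. u \<in> Hom (Cod c) Z \<and> u \<cdot> c = g \<cdot> c"
      using c comp_hom[OF ch g] unfolding is_cokernel_def by blast
    then show "g = h" using g h eq by auto
  qed
qed

end

locale pivotal_abelian_category =
  pivotal_tensor_category C + algebraically_closed_abelian_category C
  for C :: "('o, 'm, 'k::alg_closed_field, 'z) pivotal_data_scheme" (structure)
begin

text \<open>
  The unit object is simple. Let \<open>c : \<one> \<rightarrow> T\<close> be the cokernel of \<open>q\<close>. By interchange
  \<open>(q \<otimes> T) (R \<otimes> c) = c q = 0\<close>, hence \<open>q \<otimes> T = 0\<close> because \<open>R \<otimes> c\<close> is epi, and similarly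
  \<open>T \<otimes> q = 0\<close>. Therefore both coevaluations of \<open>T\<close> vanish on \<open>q\<close> and factor through \<open>c\<close>. These
  factorisations make \<open>T\<^sup>* \<otimes> c\<close> invertible and give a section of the map
  \<open>T\<^sup>* \<otimes> T \<rightarrow> T\<close> induced by \<open>c\<close>; combined they yield a section \<open>\<sigma>\<close> of \<open>c\<close>. Now \<open>\<sigma> c\<close> is a
  scalar \<open>l\<close> with \<open>l c = c\<close>. If \<open>c \<noteq> 0\<close> then \<open>l = 1\<close>, and \<open>q = \<sigma> c q = 0\<close>. So \<open>c = 0\<close>.
\<close>

lemma to_unit_epi:
  assumes q: "q \<in> Hom R \<one>" and nz: "q \<noteq> \<zero> R \<one>"
  shows "is_epi C q"
proof -
  note [simp] = homD[OF q] hom_obj[OF q]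
  obtain c where coker: "is_cokernel C c q" using cokernel_exists homD(1)[OF q] by blast
  define T where "T = Cod c"
  have c: "c \<in> Hom \<one> T" using coker by (simp add: is_cokernel_def hom_def T_def)
  have cq: "c \<cdot> q = \<zero> R T" using coker by (simp add: is_cokernel_def T_def)
  have epi_c: "is_epi C c" by (rule cokernel_epi[OF coker])
  have factor: "\<exists>u. u \<in> Hom T Z \<and> u \<cdot> c = h" if "h \<in> Hom \<one> Z" "h \<cdot> q = \<zero> R Z" for h Z
    using coker that unfolding is_cokernel_def T_def homD(2,3)[OF q] by blast
  note [simp] = homD[OF c]
  have T [simp]: "T \<in> Obj" using hom_obj[OF c] by simp
  have qT: "q \<otimes> ide T = \<zero> (R \<odot> T) T"
  proof (rule epi_cancel[OF epi_tensor(2)[OF epi_c c]])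
    show "R \<in> Obj" "ide R \<otimes> c \<in> Hom R (R \<odot> T)" "q \<otimes> ide T \<in> Hom (R \<odot> T) T"
      by (simp_all add: hom_def)
    show "\<zero> (R \<odot> T) T \<in> Hom (R \<odot> T) T" by (simp add: zero_hom)
    have "(q \<otimes> ide T) \<cdot> (ide R \<otimes> c) = c \<cdot> q" using slide(1)[OF q c] by simp
    also have "\<dots> = \<zero> (R \<odot> T) T \<cdot> (ide R \<otimes> c)"
      unfolding cq by (rule comp_zero_left[symmetric]) (simp_all add: hom_def)
    finally show "(q \<otimes> ide T) \<cdot> (ide R \<otimes> c) = \<zero> (R \<odot> T) T \<cdot> (ide R \<otimes> c)" .
  qed
  have Tq: "ide T \<otimes> q = \<zero> (T \<odot> R) T"
  proof (rule epi_cancel[OF epi_tensor(1)[OF epi_c c]])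
    show "R \<in> Obj" "c \<otimes> ide R \<in> Hom R (T \<odot> R)" "ide T \<otimes> q \<in> Hom (T \<odot> R) T"
      by (simp_all add: hom_def)
    show "\<zero> (T \<odot> R) T \<in> Hom (T \<odot> R) T" by (simp add: zero_hom)
    have "(ide T \<otimes> q) \<cdot> (c \<otimes> ide R) = c \<cdot> q" using slide[OF c q] by simp
    also have "\<dots> = \<zero> (T \<odot> R) T \<cdot> (c \<otimes> ide R)"
      unfolding cq by (rule comp_zero_left[symmetric]) (simp_all add: hom_def)
    finally show "(ide T \<otimes> q) \<cdot> (c \<otimes> ide R) = \<zero> (T \<odot> R) T \<cdot> (c \<otimes> ide R)" .
  qed
  have "coev T \<cdot> q = \<zero> R (T \<odot> dual T)"
  proof -
    have "coev T \<cdot> q = ((q \<otimes> ide T) \<otimes> ide (dual T)) \<cdot> (ide R \<otimes> coev T)"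
      using slide(1)[OF q coev_hom[OF T]] by simp
    also have "(q \<otimes> ide T) \<otimes> ide (dual T) = \<zero> (R \<odot> T \<odot> dual T) (T \<odot> dual T)"
      unfolding qT by (intro tensor_zero_left ide_hom) simp_all
    also have "\<dots> \<cdot> (ide R \<otimes> coev T) = \<zero> R (T \<odot> dual T)"
      by (rule comp_zero_left) (simp_all add: hom_def)
    finally show ?thesis .
  qed
  then obtain h where h: "h \<in> Hom T (T \<odot> dual T)" "h \<cdot> c = coev T"
    using factor[OF coev_hom[OF T]] by blast
  have "coev' T \<cdot> q = \<zero> R (dual T \<odot> T)"
  proof -
    have "coev' T \<cdot> q = (ide (dual T) \<otimes> (ide T \<otimes> q)) \<cdot> (coev' T \<otimes> ide R)"
      using slide[OF coev'_hom[OF T] q] by (simp flip: tensor_arr_assoc)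
    also have "ide (dual T) \<otimes> (ide T \<otimes> q) = \<zero> (dual T \<odot> (T \<odot> R)) (dual T \<odot> T)"
      unfolding Tq by (intro tensor_zero_right ide_hom) simp_all
    also have "\<dots> \<cdot> (coev' T \<otimes> ide R) = \<zero> R (dual T \<odot> T)"
      by (rule comp_zero_left) (simp_all add: hom_def)
    finally show ?thesis .
  qed
  then obtain y where y: "y \<in> Hom T (dual T \<odot> T)" "y \<cdot> c = coev' T"
    using factor[OF coev'_hom[OF T]] by blast
  note [simp] = homD[OF h(1)] homD[OF y(1)]
  define z where "z = (ev T \<otimes> ide (dual T)) \<cdot> (ide (dual T) \<otimes> h)"
  define e where "e = ide (dual T) \<otimes> c"
  define a where "a = ev' T \<cdot> (c \<otimes> ide (dual T))"
  have z: "z \<in> Hom (dual T \<odot> T) (dual T)" and e: "e \<in> Hom (dual T) (dual T \<odot> T)"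
    and a: "a \<in> Hom (dual T) \<one>" by (simp_all add: z_def e_def a_def hom_def)
  note [simp] = homD[OF z] homD[OF e] homD[OF a]
  have "z \<cdot> e = (ev T \<otimes> ide (dual T)) \<cdot> (ide (dual T) \<otimes> (h \<cdot> c))"
    by (simp add: z_def e_def whisker_left comp_assoc_arr)
  then have ze: "z \<cdot> e = ide (dual T)" unfolding h(2) zigzag_dual[OF T] .
  \<comment> \<open>\<open>e\<close> is epi and has the left inverse \<open>z\<close>, so \<open>z\<close> is a two-sided inverse.\<close>
  have ez: "e \<cdot> z = ide (dual T \<odot> T)"
  proof (rule epi_cancel[OF _ e])
    show "is_epi C e" unfolding e_def by (rule epi_tensor(2)[OF epi_c c]) simp
    show "e \<cdot> z \<cdot> e = ide (dual T \<odot> T) \<cdot> e" by (simp add: comp_assoc_arr ze)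
  qed (simp_all add: hom_def)
  have ay: "(a \<otimes> ide T) \<cdot> y = ide T"
  proof (rule epi_cancel[OF epi_c c])
    have "(a \<otimes> ide T) \<cdot> y \<cdot> c = (ev' T \<otimes> ide T) \<cdot> ((c \<otimes> ide (dual T \<odot> T)) \<cdot> coev' T)"
      by (simp add: a_def whisker_right comp_assoc_arr y(2))
    also have "(c \<otimes> ide (dual T \<odot> T)) \<cdot> coev' T = (ide T \<otimes> coev' T) \<cdot> c"
      using slide(1)[OF c coev'_hom[OF T]] by simp
    also have "(ev' T \<otimes> ide T) \<cdot> ((ide T \<otimes> coev' T) \<cdot> c) = ide T \<cdot> c"
      by (simp add: comp_assoc_arr[symmetric] zigzag')
    finally show "(a \<otimes> ide T) \<cdot> y \<cdot> c = ide T \<cdot> c" .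
  qed (simp_all add: hom_def)
  define \<sigma> where "\<sigma> = a \<cdot> (z \<cdot> y)"
  have \<sigma>: "\<sigma> \<in> Hom T \<one>" by (simp add: \<sigma>_def hom_def)
  note [simp] = homD[OF \<sigma>]
  have "c \<cdot> a = (a \<otimes> ide T) \<cdot> e" unfolding e_def using slide(1)[OF a c] by simp
  then have "c \<cdot> \<sigma> = (a \<otimes> ide T) \<cdot> ((e \<cdot> z) \<cdot> y)"
    unfolding \<sigma>_def by (simp add: comp_assoc_arr[symmetric])
  then have c\<sigma>: "c \<cdot> \<sigma> = ide T" unfolding ez using ay by simp
  have "\<sigma> \<cdot> c \<in> Hom \<one> \<one>" by (rule comp_hom[OF c \<sigma>])
  then obtain l where l: "\<sigma> \<cdot> c = l \<star> ide \<one>"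
    using scalars_bij unfolding bij_betw_def by blast
  have c0: "c = \<zero> \<one> T"
  proof (rule ccontr)
    assume nzc: "c \<noteq> \<zero> \<one> T"
    have "l \<star> c = c \<cdot> (\<sigma> \<cdot> c)"
      unfolding l using comp_scale_right[OF ide_hom[OF unit_obj] c] by simp
    also have "\<dots> = 1 \<star> c" using c\<sigma> scale_one[OF c] by (simp add: comp_assoc_arr[symmetric])
    finally have "l = 1" by (rule scale_cancel[OF c nzc])
    then have "q = (\<sigma> \<cdot> c) \<cdot> q" unfolding l by (simp add: scale_one[OF ide_hom])
    also have "\<dots> = \<zero> R \<one>" using cq comp_zero_right[OF \<sigma>, of R] by (simp add: comp_assoc_arr)
    finally show False using nz by simp
  qed
  show ?thesis
  proof (rule epiI[OF q])
    fix Z g h assume g: "g \<in> Hom \<one> Z" and h: "h \<in> Hom \<one> Z" and eq: "g \<cdot> q = h \<cdot> q"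
    have "(g \<ominus> h) \<cdot> q = \<zero> R Z"
      using comp_diff_left[OF q g h] diff_self[OF comp_hom[OF q h]] eq by simp
    then obtain u where u: "u \<in> Hom T Z" "u \<cdot> c = g \<ominus> h" using factor[OF diff_hom[OF g h]] by blast
    have "g \<ominus> h = \<zero> \<one> Z" using u(2) comp_zero_right[OF u(1) unit_obj] c0 by simp
    then show "g = h" by (rule diff_eq_zero[OF g h])
  qed
qed

end

section \<open>The pairing of the unit with the socle\<close>

locale unit_projective_cover = pivotal_abelian_category C
  for C :: "('o, 'm, 'k::alg_closed_field, 'z) pivotal_data_scheme" (structure) +
  fixes P \<alpha> :: 'o and p i :: 'm
  assumes P: "is_projective C P"
    and p: "p \<in> Hom P \<one>" and p_epi: "is_epi C p"
    and p_superfluous: "\<lbrakk>g \<in> Hom X P; is_epi C (p \<cdot> g)\<rbrakk> \<Longrightarrow> is_epi C g"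
    and \<alpha>: "is_simple C \<alpha>" and \<alpha>_fin: "hom_finite_length C \<alpha> \<alpha>"
    and i: "i \<in> Hom \<alpha> P" and i_mono: "is_mono C i"
    and i_socle: "\<lbrakk>is_simple C S; j \<in> Hom S P; is_mono C j\<rbrakk> \<Longrightarrow> \<exists>u \<in> Hom S \<alpha>. i \<cdot> u = j"
begin

lemma objects [simp]: "P \<in> Obj" "\<alpha> \<in> Obj"
  using hom_obj[OF i] by simp_all

lemma i_nonzero: "i \<noteq> \<zero> \<alpha> P"
proof
  assume i0: "i = \<zero> \<alpha> P"
  have z: "\<zero> \<alpha> \<alpha> \<in> Hom \<alpha> \<alpha>" by (simp add: zero_hom)
  have "i \<cdot> ide \<alpha> = i \<cdot> \<zero> \<alpha> \<alpha>"
    using comp_ide[OF i] comp_zero_right[OF i, of \<alpha>] i0 by simp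
  then have "ide \<alpha> = \<zero> \<alpha> \<alpha>"
    by (rule mono_cancel[OF i_mono i ide_hom z, rotated]) simp
  then show False using ide_simple_nonzero[OF \<alpha>] by simp
qed

lemma socle_hom_scalar:
  assumes j: "j \<in> Hom \<alpha> P"
  obtains c where "j = c \<star> i"
proof (cases "j = \<zero> \<alpha> P")
  case True
  then show ?thesis using that[of 0] scale_zero_left[OF i] by simp
next
  case False
  obtain u where u: "u \<in> Hom \<alpha> \<alpha>" "i \<cdot> u = j"
    using i_socle[OF \<alpha> j simple_mono[OF \<alpha> j False]] by blast
  obtain c where "u = c \<star> ide \<alpha>" using schur[OF u(1) \<alpha> \<alpha>_fin] by blast
  then have "j = c \<star> i"
    using u(2) comp_scale_right[OF ide_hom i] comp_ide[OF i] by simp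
  then show ?thesis by (rule that)
qed

text \<open>
  Suppose \<open>d u = c i\<close> with \<open>c \<noteq> 0\<close>. As \<open>R\<close> is injective, \<open>u\<close> extends along \<open>i\<close>, which yields an
  endomorphism \<open>x\<close> of \<open>P\<close> with \<open>x i = i\<close> and \<open>p x = 0\<close>. Then \<open>1 - x\<close> does not change \<open>p\<close>, so it
  is epi by superfluousness and has a section \<open>s\<close>. But \<open>s\<close> preserves the line spanned by \<open>i\<close>, on
  which \<open>1 - x\<close> vanishes.
\<close>

lemma radical_kills_socle:
  assumes R: "is_projective C R" and d: "d \<in> Hom R P" and pd: "p \<cdot> d = \<zero> R \<one>"
    and u: "u \<in> Hom \<alpha> R"
  shows "d \<cdot> u = \<zero> \<alpha> P"
proof -
  obtain c where c: "d \<cdot> u = c \<star> i" using socle_hom_scalar[OF comp_hom[OF u d]] .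
  have "c = 0"
  proof (rule ccontr)
    assume nz: "c \<noteq> 0"
    obtain h where h: "h \<in> Hom P R" "h \<cdot> i = u" using projective_extend[OF R i_mono i u] .
    have RO: "R \<in> Obj" using hom_obj[OF h(1)] by simp
    define x where "x = inverse c \<star> (d \<cdot> h)"
    have dh: "d \<cdot> h \<in> Hom P P" by (rule comp_hom[OF h(1) d])
    then have x: "x \<in> Hom P P" by (simp add: x_def scale_hom)
    have xi: "x \<cdot> i = i"
    proof -
      have "x \<cdot> i = inverse c \<star> (d \<cdot> u)"
        using comp_scale_left[OF i dh] comp_assoc[OF i h(1) d] h(2) by (simp add: x_def)
      also have "\<dots> = (inverse c * c) \<star> i" unfolding c by (rule scale_scale[OF i, symmetric])
      finally show ?thesis using nz scale_one[OF i] by simp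
    qed
    have px: "p \<cdot> x = \<zero> P \<one>"
    proof -
      have "p \<cdot> x = inverse c \<star> (p \<cdot> d \<cdot> h)"
        using comp_scale_right[OF dh p] comp_assoc[OF h(1) d p] by (simp add: x_def)
      also have "\<dots> = \<zero> P \<one>"
        unfolding pd using comp_zero_left[OF h(1) unit_obj] scale_zero_right[of P \<one>] by simp
      finally show ?thesis .
    qed
    let ?y = "ide P \<ominus> x"
    have id: "ide P \<in> Hom P P" by (simp add: ide_hom)
    have y: "?y \<in> Hom P P" by (rule diff_hom[OF id x])
    have yi: "?y \<cdot> i = \<zero> \<alpha> P"
      using comp_diff_left[OF i id x] ide_comp[OF i] xi diff_self[OF i] by simp
    have "p \<cdot> ?y = p"
      using comp_diff_right[OF id x p] comp_ide[OF p] px diff_zero[OF p] by simp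
    then have "is_epi C ?y" using p_superfluous[OF y] p_epi by simp
    then obtain s where s: "s \<in> Hom P P" "?y \<cdot> s = ide P"
      using projective_lift[OF P _ y id] by blast
    obtain n where n: "s \<cdot> i = n \<star> i" using socle_hom_scalar[OF comp_hom[OF i s(1)]] .
    have "i = ?y \<cdot> (s \<cdot> i)" using comp_assoc[OF i s(1) y] s(2) ide_comp[OF i] by simp
    also have "\<dots> = \<zero> \<alpha> P"
      unfolding n comp_scale_right[OF i y] yi by (rule scale_zero_right) simp_all
    finally show False using i_nonzero by simp
  qed
  then show ?thesis using c scale_zero_left[OF i] by simp
qed

definition pairing :: "'m \<Rightarrow> 'm \<Rightarrow> 'k"
  where "pairing q u = (SOME c. \<exists>e \<in> Hom (Dom q) P. p \<cdot> e = q \<and> e \<cdot> u = c \<star> i)"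

text \<open>Two lifts of the same map to \<open>\<one>\<close> differ by a map that \<open>p\<close> kills.\<close>

lemma pairing_eq:
  assumes R: "is_projective C R" and e: "e \<in> Hom R P" and u: "u \<in> Hom \<alpha> R"
  shows "e \<cdot> u = pairing (p \<cdot> e) u \<star> i"
proof -
  obtain c where "e \<cdot> u = c \<star> i" using socle_hom_scalar[OF comp_hom[OF u e]] .
  then have "\<exists>c. \<exists>e' \<in> Hom (Dom (p \<cdot> e)) P. p \<cdot> e' = p \<cdot> e \<and> e' \<cdot> u = c \<star> i"
    using e homD[OF comp_hom[OF e p]] by blast
  from someI_ex[OF this] obtain e' where e': "e' \<in> Hom R P" "p \<cdot> e' = p \<cdot> e"
    "e' \<cdot> u = pairing (p \<cdot> e) u \<star> i"
    unfolding pairing_def[symmetric] using homD[OF comp_hom[OF e p]] by auto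
  have "p \<cdot> (e \<ominus> e') = \<zero> R \<one>"
    using comp_diff_right[OF e e'(1) p] diff_self[OF comp_hom[OF e p]] e'(2) by simp
  then have "(e \<ominus> e') \<cdot> u = \<zero> \<alpha> P"
    using radical_kills_socle[OF R diff_hom[OF e e'(1)] _ u] by simp
  then have "e \<cdot> u \<ominus> e' \<cdot> u = \<zero> \<alpha> P" using comp_diff_left[OF u e e'(1)] by simp
  then have "e \<cdot> u = e' \<cdot> u" by (rule diff_eq_zero[OF comp_hom[OF u e] comp_hom[OF u e'(1)]])
  then show ?thesis using e'(3) by simp
qed

lemma pairing_eqI:
  assumes "is_projective C R" "e \<in> Hom R P" "p \<cdot> e = q" "u \<in> Hom \<alpha> R" "e \<cdot> u = c \<star> i"
  shows "pairing q u = c"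
  using pairing_eq[OF assms(1,2,4)] assms(3,5) scale_cancel[OF i i_nonzero] by simp

lemma lift_through_cover:
  assumes "is_projective C R" "q \<in> Hom R \<one>"
  obtains e where "e \<in> Hom R P" "p \<cdot> e = q"
  using projective_lift[OF assms(1) p_epi p assms(2)] .

lemma pairing_natural:
  assumes R: "is_projective C R" and S: "is_projective C S" and h: "h \<in> Hom R S"
    and q: "q \<in> Hom S \<one>" and u: "u \<in> Hom \<alpha> R"
  shows "pairing q (h \<cdot> u) = pairing (q \<cdot> h) u"
proof -
  obtain e where e: "e \<in> Hom S P" "p \<cdot> e = q" by (rule lift_through_cover[OF S q])
  show ?thesis
  proof (rule pairing_eqI[OF S e comp_hom[OF u h]])
    have "p \<cdot> (e \<cdot> h) = q \<cdot> h" using comp_assoc[OF h e(1) p] e(2) by simp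
    then show "e \<cdot> (h \<cdot> u) = pairing (q \<cdot> h) u \<star> i"
      using pairing_eq[OF R comp_hom[OF h e(1)] u] comp_assoc[OF u h e(1)] by simp
  qed
qed

lemma pairing_add:
  assumes R: "is_projective C R" and q: "q \<in> Hom R \<one>" and u: "u \<in> Hom \<alpha> R" and v: "v \<in> Hom \<alpha> R"
  shows "pairing q (u \<oplus> v) = pairing q u + pairing q v"
proof -
  obtain e where e: "e \<in> Hom R P" "p \<cdot> e = q" by (rule lift_through_cover[OF R q])
  show ?thesis
    using pairing_eq[OF R e(1) u] pairing_eq[OF R e(1) v] e(2)
    by (intro pairing_eqI[OF R e add_hom[OF u v]])
      (simp add: comp_add_right[OF u v e(1)] scale_add_left[OF i])
qed

lemma pairing_scale:
  assumes R: "is_projective C R" and q: "q \<in> Hom R \<one>" and u: "u \<in> Hom \<alpha> R"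
  shows "pairing q (a \<star> u) = a * pairing q u"
proof -
  obtain e where e: "e \<in> Hom R P" "p \<cdot> e = q" by (rule lift_through_cover[OF R q])
  show ?thesis
    using pairing_eq[OF R e(1) u] e(2)
    by (intro pairing_eqI[OF R e scale_hom[OF u]])
      (simp add: comp_scale_right[OF u e(1)] scale_scale[OF i])
qed

text \<open>
  A nonzero \<open>q\<close> is epi, so its lift to \<open>P\<close> is a split epi, and its section maps the socle of \<open>P\<close>
  into \<open>R\<close>.
\<close>

lemma pairing_nondegenerate_left:
  assumes R: "is_projective C R" and q: "q \<in> Hom R \<one>" and nz: "q \<noteq> \<zero> R \<one>"
  obtains u where "u \<in> Hom \<alpha> R" "pairing q u = 1"
proof -
  obtain e where e: "e \<in> Hom R P" "p \<cdot> e = q" by (rule lift_through_cover[OF R q])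
  have "is_epi C (p \<cdot> e)" using e(2) to_unit_epi[OF q nz] by simp
  then have "is_epi C e" by (rule p_superfluous[OF e(1)])
  then obtain s where s: "s \<in> Hom P R" "e \<cdot> s = ide P"
    using projective_lift[OF P _ e(1), of "ide P"] by (auto simp: ide_hom)
  have "e \<cdot> (s \<cdot> i) = 1 \<star> i"
    using comp_assoc[OF i s(1) e(1)] s(2) ide_comp[OF i] scale_one[OF i] by simp
  then have "pairing q (s \<cdot> i) = 1" by (rule pairing_eqI[OF R e comp_hom[OF i s(1)]])
  then show ?thesis using that comp_hom[OF i s(1)] by blast
qed

text \<open>A nonzero \<open>u\<close> is mono, so the injectivity of \<open>P\<close> provides a retraction of \<open>u\<close> onto \<open>i\<close>.\<close>

lemma pairing_nondegenerate_right:
  assumes R: "is_projective C R" and u: "u \<in> Hom \<alpha> R" and nz: "u \<noteq> \<zero> \<alpha> R"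
  obtains q where "q \<in> Hom R \<one>" "pairing q u = 1"
proof -
  obtain r where r: "r \<in> Hom R P" "r \<cdot> u = i"
    using projective_extend[OF P simple_mono[OF \<alpha> u nz] u i] .
  have "r \<cdot> u = 1 \<star> i" using r(2) scale_one[OF i] by simp
  then have "pairing (p \<cdot> r) u = 1" by (rule pairing_eqI[OF R r(1) refl u])
  then show ?thesis using that comp_hom[OF r(1) p] by blast
qed

section \<open>The trace on projective objects\<close>

abbreviation name_of :: "'o \<Rightarrow> 'm \<Rightarrow> 'm"
  where "name_of V f \<equiv> (f \<otimes> ide (dual V)) \<cdot> (ide \<alpha> \<otimes> coev V)"

definition projective_trace :: "'o \<Rightarrow> 'm \<Rightarrow> 'k"
  where "projective_trace V f = pairing (ev' V) (name_of V f)"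

lemma name_of_hom: "\<lbrakk>f \<in> Hom (\<alpha> \<odot> V) W; V \<in> Obj\<rbrakk> \<Longrightarrow> name_of V f \<in> Hom \<alpha> (W \<odot> dual V)"
  using hom_obj(2)[of f] by (simp add: hom_def)

lemma name_of_comp:
  assumes f: "f \<in> Hom (\<alpha> \<odot> V) W" and V [simp]: "V \<in> Obj" and g: "g \<in> Hom W U"
  shows "name_of V (g \<cdot> f) = (g \<otimes> ide (dual V)) \<cdot> name_of V f"
  using homD[OF f] homD[OF g] by (simp add: whisker_right comp_assoc_arr)

text \<open>
  In this form the trace pairing is the pairing of \<open>Hom (V \<otimes> Q\<^sup>*) \<one>\<close> with
  \<open>Hom \<alpha> (V \<otimes> Q\<^sup>*)\<close>, because \<open>g\<close> and \<open>f\<close> range over transposes of arbitrary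
  elements of these two spaces.
\<close>

lemma projective_trace_comp:
  assumes Q: "is_projective C Q" and f: "f \<in> Hom (\<alpha> \<odot> Q) V" and g: "g \<in> Hom V Q"
  shows "projective_trace Q (g \<cdot> f) = pairing (ev' Q \<cdot> (g \<otimes> ide (dual Q))) (name_of Q f)"
proof -
  have QO [simp]: "Q \<in> Obj" using hom_obj[OF g] by simp
  have V [simp]: "V \<in> Obj" using hom_obj[OF g] by simp
  show ?thesis
    unfolding projective_trace_def name_of_comp[OF f QO g]
    by (rule pairing_natural[OF projective_tensor(2)[OF projective_dual[OF Q] V]
          projective_tensor(1)[OF Q dual_obj[OF QO]] tensor_hom[OF g ide_hom] ev'_hom[OF QO]
          name_of_hom[OF f QO]]) simp
qed

text \<open>
  Both sides pair over \<open>U \<otimes> V\<^sup>*\<close>: the left side after moving \<open>g\<close> into the evaluation, the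
  right side after moving the dual of \<open>g\<close>, and these two evaluations agree.
\<close>

lemma projective_trace_cyclic:
  assumes U: "is_projective C U" and V: "is_projective C V"
    and f: "f \<in> Hom (\<alpha> \<odot> V) U" and g: "g \<in> Hom U V"
  shows "projective_trace V (g \<cdot> f) = projective_trace U (f \<cdot> (ide \<alpha> \<otimes> g))"
proof -
  have O [simp]: "U \<in> Obj" "V \<in> Obj" using hom_obj[OF g] .
  note [simp] = homD[OF f] homD[OF g] homD[OF dual_arr_hom[OF g]]
  have "name_of U (f \<cdot> (ide \<alpha> \<otimes> g)) = (f \<otimes> ide (dual U)) \<cdot> (ide \<alpha> \<otimes> ((g \<otimes> ide (dual U)) \<cdot> coev U))"
    by (simp add: whisker_left whisker_right comp_assoc_arr)
  also have "\<dots> = (f \<otimes> ide (dual U)) \<cdot> ((ide (\<alpha> \<odot> V) \<otimes> dual_arr C g) \<cdot> (ide \<alpha> \<otimes> coev V))"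
    unfolding coev_dual_arr[OF g]
    by (simp add: whisker_left del: tensor_ide) (simp flip: tensor_ide)
  also have "\<dots> = (ide U \<otimes> dual_arr C g) \<cdot> name_of V f"
    using slide(1)[OF f dual_arr_hom[OF g]] by (simp add: comp_assoc_arr[symmetric])
  finally have n: "name_of U (f \<cdot> (ide \<alpha> \<otimes> g)) = (ide U \<otimes> dual_arr C g) \<cdot> name_of V f" .
  have "projective_trace V (g \<cdot> f) = pairing (ev' V \<cdot> (g \<otimes> ide (dual V))) (name_of V f)"
    by (rule projective_trace_comp[OF V f g])
  also have "ev' V \<cdot> (g \<otimes> ide (dual V)) = ev' U \<cdot> (ide U \<otimes> dual_arr C g)"
    by (rule ev'_dual_arr[OF g])
  also have "pairing \<dots> (name_of V f) = projective_trace U (f \<cdot> (ide \<alpha> \<otimes> g))"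
    unfolding projective_trace_def n
    by (rule pairing_natural[symmetric, OF projective_tensor(1)[OF U] projective_tensor(1)[OF U]
          tensor_hom[OF ide_hom dual_arr_hom[OF g]] ev'_hom name_of_hom[OF f]]) simp_all
  finally show ?thesis .
qed

text \<open>
  Both sides pair over \<open>U \<otimes> W \<otimes> W\<^sup>* \<otimes> U\<^sup>*\<close> with the transpose \<open>w\<close> of \<open>f\<close> along the nested
  coevaluations. The partial trace caps off \<open>W\<close> in \<open>w\<close>, and naturality moves that cap into
  \<open>ev' U\<close>.
\<close>

lemma projective_trace_partial:
  assumes U: "is_projective C U" and W [simp]: "W \<in> Obj" and f: "f \<in> Hom (\<alpha> \<odot> U \<odot> W) (U \<odot> W)"
  shows "projective_trace (U \<odot> W) f = projective_trace U (right_partial_trace C (\<alpha> \<odot> U) U W f)"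
proof -
  have O [simp]: "U \<in> Obj" using U by (simp add: is_projective_def)
  note [simp] = homD[OF f]
  let ?\<phi> = "dual_tensor_iso C U W" and ?\<eta> = "(ide U \<otimes> coev W \<otimes> ide (dual U)) \<cdot> coev U"
  note \<phi> = dual_tensor_iso_hom[OF O W]
  note [simp] = homD[OF \<phi>]
  define w where "w = (f \<otimes> ide (dual W \<odot> dual U)) \<cdot> (ide \<alpha> \<otimes> ?\<eta>)"
  have w: "w \<in> Hom \<alpha> (U \<odot> W \<odot> (dual W \<odot> dual U))" by (simp add: w_def hom_def)
  have "name_of (U \<odot> W) f = (f \<otimes> ide (dual (U \<odot> W))) \<cdot> ((ide (\<alpha> \<odot> U \<odot> W) \<otimes> ?\<phi>) \<cdot> (ide \<alpha> \<otimes> ?\<eta>))"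
    unfolding coev_tensor[OF O W, symmetric]
    by (simp add: whisker_left del: tensor_ide) (simp flip: tensor_ide)
  also have "\<dots> = (ide (U \<odot> W) \<otimes> ?\<phi>) \<cdot> w"
    unfolding w_def using slide(1)[OF f \<phi>] by (simp add: comp_assoc_arr[symmetric])
  finally have n1: "name_of (U \<odot> W) f = (ide (U \<odot> W) \<otimes> ?\<phi>) \<cdot> w" .
  have n2: "name_of U (right_partial_trace C (\<alpha> \<odot> U) U W f) = (ide U \<otimes> ev' W \<otimes> ide (dual U)) \<cdot> w"
    unfolding w_def right_partial_trace_def
    by (simp add: whisker_left whisker_right comp_assoc_arr del: tensor_ide)
      (simp add: comp_assoc_arr flip: tensor_ide)
  have R: "is_projective C (U \<odot> W \<odot> (dual W \<odot> dual U))"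
    "is_projective C (U \<odot> W \<odot> dual (U \<odot> W))" "is_projective C (U \<odot> dual U)"
    using U by (simp_all add: projective_tensor)
  have "projective_trace (U \<odot> W) f = pairing (ev' (U \<odot> W) \<cdot> (ide (U \<odot> W) \<otimes> ?\<phi>)) w"
    unfolding projective_trace_def n1
    by (rule pairing_natural[OF R(1,2) tensor_hom[OF ide_hom \<phi>] ev'_hom w]) simp_all
  also have "ev' (U \<odot> W) \<cdot> (ide (U \<odot> W) \<otimes> ?\<phi>) = ev' U \<cdot> (ide U \<otimes> ev' W \<otimes> ide (dual U))"
    by (rule ev'_tensor[OF O W])
  also have "pairing \<dots> w = projective_trace U (right_partial_trace C (\<alpha> \<odot> U) U W f)"
    unfolding projective_trace_def n2
    by (rule pairing_natural[symmetric, OF R(1,3) _ ev'_hom w]) (simp_all add: hom_def)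
  finally show ?thesis .
qed

lemma projective_trace_right_trace: "is_right_trace C \<alpha> (projectives C) projective_trace"
  unfolding is_right_trace_def projectives_def mem_Collect_eq
proof (intro conjI ballI allI)
  show "right_ideal C {Q. is_projective C Q}"
    using right_ideal_projectives by (simp add: projectives_def)
next
  fix V f g assume "V \<in> {Q. is_projective C Q}" and f: "f \<in> Hom (\<alpha> \<odot> V) V" and g: "g \<in> Hom (\<alpha> \<odot> V) V"
  then have V: "is_projective C V" by simp
  have O [simp]: "V \<in> Obj" using hom_obj[OF f] by simp
  note [simp] = homD[OF f] homD[OF g] homD[OF add_hom[OF f g]]
  have "name_of V (f \<oplus> g) = name_of V f \<oplus> name_of V g"
    using tensor_add_left[OF f g]
      comp_add_left[of "ide \<alpha> \<otimes> coev V" \<alpha> "\<alpha> \<odot> V \<odot> dual V" "f \<otimes> ide (dual V)" "V \<odot> dual V" "g \<otimes> ide (dual V)"]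
    by (simp add: hom_def)
  then show "projective_trace V (f \<oplus> g) = projective_trace V f + projective_trace V g"
    unfolding projective_trace_def
    using pairing_add[OF projective_tensor(1)[OF V dual_obj[OF O]] ev'_hom[OF O] name_of_hom[OF f O] name_of_hom[OF g O]]
    by simp
next
  fix V f a assume "V \<in> {Q. is_projective C Q}" and f: "f \<in> Hom (\<alpha> \<odot> V) V"
  then have V: "is_projective C V" by simp
  have O [simp]: "V \<in> Obj" using hom_obj[OF f] by simp
  note [simp] = homD[OF f] homD[OF scale_hom[OF f]]
  have "name_of V (a \<star> f) = a \<star> name_of V f"
    using tensor_scale_left[of f "ide (dual V)" a]
      comp_scale_left[of "ide \<alpha> \<otimes> coev V" \<alpha> "\<alpha> \<odot> V \<odot> dual V" "f \<otimes> ide (dual V)" "V \<odot> dual V" a]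
    by (simp add: hom_def)
  then show "projective_trace V (a \<star> f) = a * projective_trace V f"
    unfolding projective_trace_def
    using pairing_scale[OF projective_tensor(1)[OF V dual_obj[OF O]] ev'_hom[OF O] name_of_hom[OF f O]]
    by simp
next
  fix U W f assume "U \<in> {Q. is_projective C Q}" "W \<in> Obj" "f \<in> Hom (\<alpha> \<odot> U \<odot> W) (U \<odot> W)"
  then show "projective_trace (U \<odot> W) f = projective_trace U (right_partial_trace C (\<alpha> \<odot> U) U W f)"
    using projective_trace_partial by simp
next
  fix U V f g
  assume "U \<in> {Q. is_projective C Q}" "V \<in> {Q. is_projective C Q}" "f \<in> Hom (\<alpha> \<odot> V) U" "g \<in> Hom U V"
  then show "projective_trace V (g \<cdot> f) = projective_trace U (f \<cdot> (ide \<alpha> \<otimes> g))"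
    using projective_trace_cyclic by simp
qed

lemma projective_trace_nondegenerate: "trace_nondegenerate C \<alpha> (projectives C) projective_trace"
  unfolding trace_nondegenerate_def projectives_def
proof (intro ballI conjI impI)
  fix Q V assume "Q \<in> {Q. is_projective C Q}" and V [simp]: "V \<in> Obj"
  then have Q: "is_projective C Q" and QO [simp]: "Q \<in> Obj" by (simp_all add: is_projective_def)
  note R = projective_tensor(2)[OF projective_dual[OF Q] V]
  {
    fix g assume g: "g \<in> Hom V Q" and all: "\<forall>f \<in> Hom (\<alpha> \<odot> Q) V. projective_trace Q (g \<cdot> f) = 0"
    note [simp] = homD[OF g]
    let ?q = "ev' Q \<cdot> (g \<otimes> ide (dual Q))"
    have q: "?q \<in> Hom (V \<odot> dual Q) \<one>" by (simp add: hom_def)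
    have "?q = \<zero> (V \<odot> dual Q) \<one>"
    proof (rule ccontr)
      assume "?q \<noteq> \<zero> (V \<odot> dual Q) \<one>"
      then obtain u where u: "u \<in> Hom \<alpha> (V \<odot> dual Q)" "pairing ?q u = 1"
        using pairing_nondegenerate_left[OF R q] by blast
      define f where "f = (ide V \<otimes> ev Q) \<cdot> (u \<otimes> ide Q)"
      have f: "f \<in> Hom (\<alpha> \<odot> Q) V"
        unfolding f_def by (rule dual_pair.unbend_right_hom[OF left_dual_pair[OF QO] u(1) V])
      have "name_of Q f = u"
        unfolding f_def by (rule dual_pair.bend_unbend_right[OF left_dual_pair[OF QO] u(1) V])
      then have "projective_trace Q (g \<cdot> f) = 1" using projective_trace_comp[OF Q f g] u(2) by simp
      then show False using all f by simp
    qed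
    moreover have "g = (?q \<otimes> ide Q) \<cdot> (ide V \<otimes> coev' Q)"
    proof -
      have "(?q \<otimes> ide Q) \<cdot> (ide V \<otimes> coev' Q) = (ev' Q \<otimes> ide Q) \<cdot> ((g \<otimes> ide (dual Q \<odot> Q)) \<cdot> (ide V \<otimes> coev' Q))"
        by (simp add: whisker_right comp_assoc_arr)
      also have "(g \<otimes> ide (dual Q \<odot> Q)) \<cdot> (ide V \<otimes> coev' Q) = (ide Q \<otimes> coev' Q) \<cdot> g"
        using slide(1)[OF g coev'_hom[OF QO]] by simp
      also have "(ev' Q \<otimes> ide Q) \<cdot> ((ide Q \<otimes> coev' Q) \<cdot> g) = g"
        by (simp add: comp_assoc_arr[symmetric] zigzag')
      finally show ?thesis by simp
    qed
    ultimately have "g = \<zero> (V \<odot> dual Q \<odot> Q) Q \<cdot> (ide V \<otimes> coev' Q)"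
      using tensor_zero_left[of "V \<odot> dual Q" \<one> "ide Q" Q Q] ide_hom[of Q] by simp
    then show "g = \<zero> V Q"
      using comp_zero_left[of "ide V \<otimes> coev' Q" V "V \<odot> dual Q \<odot> Q" Q] by (simp add: hom_def)
  next
    fix f assume f: "f \<in> Hom (\<alpha> \<odot> Q) V" and all: "\<forall>g \<in> Hom V Q. projective_trace Q (g \<cdot> f) = 0"
    have "name_of Q f = \<zero> \<alpha> (V \<odot> dual Q)"
    proof (rule ccontr)
      assume "name_of Q f \<noteq> \<zero> \<alpha> (V \<odot> dual Q)"
      then obtain q where q: "q \<in> Hom (V \<odot> dual Q) \<one>" "pairing q (name_of Q f) = 1"
        using pairing_nondegenerate_right[OF R name_of_hom[OF f QO]] by blast
      define g where "g = (q \<otimes> ide Q) \<cdot> (ide V \<otimes> coev' Q)"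
      have "g \<in> Hom V (\<one> \<odot> Q)"
        unfolding g_def by (rule dual_pair.bend_right_hom[OF right_dual_pair[OF QO] q(1) V])
      then have g: "g \<in> Hom V Q" by simp
      have "ev' Q \<cdot> (g \<otimes> ide (dual Q)) = q"
        using dual_pair.unbend_bend_right[OF right_dual_pair[OF QO] q(1) V]
        by (simp add: g_def)
      then have "projective_trace Q (g \<cdot> f) = 1" using projective_trace_comp[OF Q f g] q(2) by simp
      then show False using all g by simp
    qed
    then have "f = (ide V \<otimes> ev Q) \<cdot> (\<zero> \<alpha> (V \<odot> dual Q) \<otimes> ide Q)"
      using dual_pair.unbend_bend_right[OF left_dual_pair[OF QO] f] by simp
    also have "\<zero> \<alpha> (V \<odot> dual Q) \<otimes> ide Q = \<zero> (\<alpha> \<odot> Q) (V \<odot> dual Q \<odot> Q)"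
      using tensor_zero_left[of \<alpha> "V \<odot> dual Q" "ide Q" Q Q] ide_hom[of Q] by simp
    also have "(ide V \<otimes> ev Q) \<cdot> \<dots> = \<zero> (\<alpha> \<odot> Q) V"
      by (rule comp_zero_right) (simp_all add: hom_def)
    finally show "f = \<zero> (\<alpha> \<odot> Q) V" .
  }
qed

text \<open>
  Since \<open>s\<close> below is a section of \<open>p \<otimes> Q\<close>, cyclicity moves the trace from \<open>Q\<close> to \<open>P \<otimes> Q\<close>.
  The partial trace over \<open>Q\<close> then factors as \<open>\<alpha> \<otimes> P \<rightarrow> \<alpha> \<rightarrow> P\<close>, where the second arrow is
  \<open>e\<close> applied to the transpose of \<open>f\<close>, the multiple of \<open>i\<close> that defines the trace of \<open>f\<close>.
\<close>

lemma right_trace_unique: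
  assumes t: "is_right_trace C \<alpha> (projectives C) t" and Q: "is_projective C Q"
    and f: "f \<in> Hom (\<alpha> \<odot> Q) Q"
  shows "t Q f = t P (i \<otimes> p) * projective_trace Q f"
proof -
  have scale: "t V (a \<star> h) = a * t V h"
    if "is_projective C V" "h \<in> Hom (\<alpha> \<odot> V) V" for V h a
    using t that by (simp add: is_right_trace_def projectives_def)
  have partial: "t (U \<odot> W) h = t U (right_partial_trace C (\<alpha> \<odot> U) U W h)"
    if "is_projective C U" "W \<in> Obj" "h \<in> Hom (\<alpha> \<odot> U \<odot> W) (U \<odot> W)" for U W h
    using t that by (simp add: is_right_trace_def projectives_def)
  have cyclic: "t V (g \<cdot> h) = t U (h \<cdot> (ide \<alpha> \<otimes> g))"
    if "is_projective C U" "is_projective C V" "h \<in> Hom (\<alpha> \<odot> V) U" "g \<in> Hom U V" for U V g h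
    using t that by (simp add: is_right_trace_def projectives_def)
  have QO [simp]: "Q \<in> Obj" using hom_obj[OF f] by simp
  note [simp] = homD[OF f] homD[OF p] homD[OF i]
  obtain e where e: "e \<in> Hom (Q \<odot> dual Q) P" "p \<cdot> e = ev' Q"
    using lift_through_cover[OF projective_tensor(1)[OF Q dual_obj[OF QO]] ev'_hom[OF QO]] .
  note [simp] = homD[OF e(1)]
  \<comment> \<open>The transpose of a lift of \<open>ev' Q\<close> is a section of \<open>p \<otimes> Q\<close>, by the zigzag identity.\<close>
  define s where "s = (e \<otimes> ide Q) \<cdot> (ide Q \<otimes> coev' Q)"
  have s: "s \<in> Hom Q (P \<odot> Q)" by (simp add: s_def hom_def)
  note [simp] = homD[OF s]
  have split: "(p \<otimes> ide Q) \<cdot> s = ide Q"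
  proof -
    have "(p \<otimes> ide Q) \<cdot> s = ((p \<cdot> e) \<otimes> ide Q) \<cdot> (ide Q \<otimes> coev' Q)"
      by (simp add: s_def whisker_right comp_assoc_arr)
    then show ?thesis unfolding e(2) by (simp add: zigzag')
  qed
  have unbend: "(ide P \<otimes> ev' Q) \<cdot> (s \<otimes> ide (dual Q)) = e"
    using dual_pair.unbend_bend_right[OF right_dual_pair[OF QO] e(1) QO] by (simp add: s_def)
  let ?c = "projective_trace Q f"
  have c: "e \<cdot> name_of Q f = ?c \<star> i"
    using pairing_eq[OF projective_tensor(1)[OF Q dual_obj[OF QO]] e(1) name_of_hom[OF f QO]] e(2)
    by (simp add: projective_trace_def)
  have "t Q f = t Q ((p \<otimes> ide Q) \<cdot> (s \<cdot> f))"
    by (simp add: comp_assoc_arr[symmetric] split)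
  also have "\<dots> = t (P \<odot> Q) (s \<cdot> f \<cdot> (ide \<alpha> \<otimes> (p \<otimes> ide Q)))"
    by (rule cyclic) (use P Q in \<open>simp_all add: projective_tensor hom_def\<close>)
  also have "\<dots> = t P (right_partial_trace C (\<alpha> \<odot> P) P Q (s \<cdot> f \<cdot> (ide \<alpha> \<otimes> (p \<otimes> ide Q))))"
    by (rule partial) (use P in \<open>simp_all add: hom_def\<close>)
  also have "right_partial_trace C (\<alpha> \<odot> P) P Q (s \<cdot> f \<cdot> (ide \<alpha> \<otimes> (p \<otimes> ide Q))) = ?c \<star> (i \<otimes> p)"
  proof -
    have "right_partial_trace C (\<alpha> \<odot> P) P Q (s \<cdot> f \<cdot> (ide \<alpha> \<otimes> (p \<otimes> ide Q)))
        = ((ide P \<otimes> ev' Q) \<cdot> (s \<otimes> ide (dual Q))) \<cdot> ((f \<otimes> ide (dual Q)) \<cdot>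
          (ide \<alpha> \<otimes> ((p \<otimes> ide (Q \<odot> dual Q)) \<cdot> (ide P \<otimes> coev Q))))"
      unfolding right_partial_trace_def
      by (simp add: whisker_left whisker_right comp_assoc_arr del: tensor_ide)
        (simp add: comp_assoc_arr flip: tensor_ide)
    also have "(p \<otimes> ide (Q \<odot> dual Q)) \<cdot> (ide P \<otimes> coev Q) = coev Q \<cdot> p"
      using slide(1)[OF p coev_hom[OF QO]] by simp
    also have "((ide P \<otimes> ev' Q) \<cdot> (s \<otimes> ide (dual Q))) \<cdot> ((f \<otimes> ide (dual Q)) \<cdot> (ide \<alpha> \<otimes> (coev Q \<cdot> p)))
        = (e \<cdot> name_of Q f) \<cdot> (ide \<alpha> \<otimes> p)"
      unfolding unbend by (simp add: whisker_left comp_assoc_arr)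
    also have "\<dots> = ?c \<star> (i \<cdot> (ide \<alpha> \<otimes> p))"
      unfolding c by (rule comp_scale_left[OF _ i]) (simp add: hom_def)
    also have "i \<cdot> (ide \<alpha> \<otimes> p) = i \<otimes> p"
      using slide(2)[OF i p] by simp
    finally show ?thesis .
  qed
  also have "t P (?c \<star> (i \<otimes> p)) = ?c * t P (i \<otimes> p)"
    by (rule scale[OF P]) (simp add: hom_def)
  finally show ?thesis by (simp add: mult.commute)
qed

end

section \<open>Existence, uniqueness and nondegeneracy\<close>

theorem corollary5p6:
  fixes C :: "('o, 'm, 'k::alg_closed_field) pivotal_data" (structure)
    and P \<alpha> :: 'o
  assumes "pivotal_tensor_category C"
    and "abelian_category C"
    and "locally_finite C"
    and "enough_projectives C"
    and "is_projective_cover C P \<one>"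
    and "is_socle C \<alpha> P"
  shows "\<exists>t :: 'o \<Rightarrow> 'm \<Rightarrow> 'k.
    is_right_trace C \<alpha> (projectives C) t \<and>
    (\<forall>t'. is_right_trace C \<alpha> (projectives C) t' \<longrightarrow>
      (\<exists>c. \<forall>Q \<in> projectives C. \<forall>f \<in> Hom (\<alpha> \<odot> Q) Q. t' Q f = c * t Q f)) \<and>
    trace_nondegenerate C \<alpha> (projectives C) t"
proof -
  interpret pivotal_tensor_category C by fact
  interpret abelian_category C by fact
  obtain p where p: "p \<in> Hom P \<one>" "is_epi C p"
    "\<forall>g \<in> Arr. Cod g = P \<and> is_epi C (p \<cdot> g) \<longrightarrow> is_epi C g" and P: "is_projective C P"
    using \<open>is_projective_cover C P \<one>\<close> unfolding is_projective_cover_def by blast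
  obtain i where i: "i \<in> Hom \<alpha> P" "is_mono C i"
    "\<forall>S. \<forall>j \<in> Hom S P. is_simple C S \<and> is_mono C j \<longrightarrow> (\<exists>u \<in> Hom S \<alpha>. is_iso C u \<and> i \<cdot> u = j)"
    and \<alpha>: "is_simple C \<alpha>"
    using \<open>is_socle C \<alpha> P\<close> unfolding is_socle_def by blast
  interpret unit_projective_cover C P \<alpha> p i
  proof unfold_locales
    show "hom_finite_length C \<alpha> \<alpha>"
      using \<open>locally_finite C\<close> \<alpha> by (simp add: locally_finite_def is_simple_def)
    show "is_epi C g" if "g \<in> Hom X P" "is_epi C (p \<cdot> g)" for g X
      using p(3) that homD[OF that(1)] by blast
    show "\<exists>u \<in> Hom S \<alpha>. i \<cdot> u = j" if "is_simple C S" "j \<in> Hom S P" "is_mono C j" for S j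
      using i(3) that by blast
  qed (fact P p(1,2) i(1,2) \<alpha>)+
  show ?thesis
  proof (intro exI[of _ projective_trace] conjI allI impI)
    fix t' assume "is_right_trace C \<alpha> (projectives C) t'"
    then show "\<exists>c. \<forall>Q \<in> projectives C. \<forall>f \<in> Hom (\<alpha> \<odot> Q) Q. t' Q f = c * projective_trace Q f"
      using right_trace_unique by (intro exI[of _ "t' P (i \<otimes> p)"]) (simp add: projectives_def)
  qed (fact projective_trace_right_trace projective_trace_nondegenerate)+
qed

end
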